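(* Let $G=(V,E)$ be a finite simple undirected planar graph that contains no triangle (no cycle of length $3$) and has no isolated vertices, with $V=\{v_1,\dots,v_n\}$ and $d_i$ the degree of $v_i$. Let $r_1,\dots,r_n$ be real numbers with $0<r_i<1$, and put $w_i=d_i+r_i$. Suppose each vertex $v\in V$ marks one of its neighbors $v_i$ whose weight $w_i$ is maximum among the weights of all neighbors of $v$, and let $V'\subseteq V$ be the set of all vertices marked by at least one vertex (the output of the marking algorithm with $m=0$). Then $V'$ is an approximate solution with factor $16$ for the minimum total dominating set problem and with factor $32$ for the minimum dominating set problem; that is, $V'$ is a total dominating set of $G$ (hence also a dominating set), and $$|V'|\le 16\,\gamma_t(G)\qquad\text{and}\qquad |V'|\le 32\,\gamma(G).$$
   Context: A set $S\subseteq V$ is a dominating set of $G=(V,E)$ if each vertex $v\in V\setminus S$ has a neighbor in $S$. A set $S\subseteq V$ is a total dominating set of $G$ if each vertex $v\in V$ (including those in $S$) has a neighbor in $S$. $\gamma(G)$ denotes the minimum size of a dominating set of $G$, and $\gamma_t(G)$ denotes the minimum size of a total dominating set of $G$ (which exists when $G$ has no isolated vertices). The minimum dominating set (MDS) problem and the minimum total dominating set (MTDS) problem ask for sets of these sizes. An algorithm has approximation factor $c$ for one of these problems if its output is a feasible set of size at most $c$ times the minimum. The marking algorithm with $m=0$ is a local distributed algorithm: in the first round each vertex $v_i$ chooses a random number $0<r_i<1$, computes the weight $w_i=d_i+r_i$, and sends it to its neighbors; in the second round each vertex marks a neighbor of maximum weight; the marked vertices are the output. (Adjacency is open: a vertex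 is not its own neighbor.) The guarantee is a worst-case one, for every choice of the numbers $r_i$ and every choice of a maximum-weight neighbor in case of ties. *)

theory Defs
  imports "HOL-Analysis.Analysis"
begin

text \<open>A finite simple undirected graph is given by a vertex set \<open>V\<close> and a set \<open>E\<close> of two-element
  subsets of \<open>V\<close>; in particular there are no loops and no parallel edges.\<close>

definition simple_graph :: "'a set \<Rightarrow> 'a set set \<Rightarrow> bool" where
  "simple_graph V E \<longleftrightarrow> finite V \<and> (\<forall>e\<in>E. e \<subseteq> V \<and> card e = 2)"

definition neighbors :: "'a set set \<Rightarrow> 'a \<Rightarrow> 'a set" where
  "neighbors E v = {u. {v, u} \<in> E}"

definition degree :: "'a set set \<Rightarrow> 'a \<Rightarrow> nat" where
  "degree E v = card (neighbors E v)"

definition no_isolated_vertices :: "'a set \<Rightarrow> 'a set set \<Rightarrow> bool" where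
  "no_isolated_vertices V E \<longleftrightarrow> (\<forall>v\<in>V. neighbors E v \<noteq> {})"

text \<open>The three vertices of a triangle need not be required to be distinct: in a simple graph
  every edge has two elements.\<close>

definition triangle_free :: "'a set set \<Rightarrow> bool" where
  "triangle_free E \<longleftrightarrow> \<not> (\<exists>a b c. {a, b} \<in> E \<and> {b, c} \<in> E \<and> {a, c} \<in> E)"

text \<open>A drawing without crossings, in the plane \<^typ>\<open>complex\<close>: vertices are distinct points, edges
  are arcs (injective paths) joining their end vertices, an edge passes through no vertex other
  than its ends, and two distinct edges meet at most in a common end vertex.\<close>

definition plane_drawing ::
    "'a set \<Rightarrow> 'a set set \<Rightarrow> ('a \<Rightarrow> complex) \<Rightarrow> ('a set \<Rightarrow> real \<Rightarrow> complex) \<Rightarrow> bool" where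
  "plane_drawing V E pos crv \<longleftrightarrow>
     inj_on pos V \<and>
     (\<forall>e\<in>E. arc (crv e) \<and> {pathstart (crv e), pathfinish (crv e)} = pos ` e) \<and>
     (\<forall>e\<in>E. \<forall>v\<in>V. pos v \<in> path_image (crv e) \<longrightarrow> v \<in> e) \<and>
     (\<forall>e\<in>E. \<forall>f\<in>E. e \<noteq> f \<longrightarrow> path_image (crv e) \<inter> path_image (crv f) \<subseteq> pos ` (e \<inter> f))"

definition planar :: "'a set \<Rightarrow> 'a set set \<Rightarrow> bool" where
  "planar V E \<longleftrightarrow> (\<exists>pos crv. plane_drawing V E pos crv)"

definition dominating_set :: "'a set \<Rightarrow> 'a set set \<Rightarrow> 'a set \<Rightarrow> bool" where
  "dominating_set V E S \<longleftrightarrow> S \<subseteq> V \<and> (\<forall>v\<in>V - S. \<exists>u\<in>S. u \<in> neighbors E v)"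

definition total_dominating_set :: "'a set \<Rightarrow> 'a set set \<Rightarrow> 'a set \<Rightarrow> bool" where
  "total_dominating_set V E S \<longleftrightarrow> S \<subseteq> V \<and> (\<forall>v\<in>V. \<exists>u\<in>S. u \<in> neighbors E v)"

definition domination_number :: "'a set \<Rightarrow> 'a set set \<Rightarrow> nat" where
  "domination_number V E = (LEAST k. \<exists>S. dominating_set V E S \<and> card S = k)"

text \<open>Meaningful only for graphs without isolated vertices; otherwise there is no total dominating
  set and the value is unspecified.\<close>

definition total_domination_number :: "'a set \<Rightarrow> 'a set set \<Rightarrow> nat" where
  "total_domination_number V E = (LEAST k. \<exists>S. total_dominating_set V E S \<and> card S = k)"

definition weight :: "'a set set \<Rightarrow> ('a \<Rightarrow> real) \<Rightarrow> 'a \<Rightarrow> real" where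
  "weight E r v = real (degree E v) + r v"

text \<open>\<open>mark v\<close> is the neighbor marked by \<open>v\<close>; any choice is allowed among neighbors of equal
  maximum weight. The output of the algorithm is the image \<open>mark ` V\<close>.\<close>

definition valid_marking :: "'a set \<Rightarrow> 'a set set \<Rightarrow> ('a \<Rightarrow> real) \<Rightarrow> ('a \<Rightarrow> 'a) \<Rightarrow> bool" where
  "valid_marking V E r mark \<longleftrightarrow>
     (\<forall>v\<in>V. mark v \<in> neighbors E v \<and>
            (\<forall>u\<in>neighbors E v. weight E r u \<le> weight E r (mark v)))"

end

theory Submission
  imports Defs
begin

text \<open>Let \<open>S\<close> be a total dominating set, let \<open>\<sigma> v \<in> S\<close> be a neighbor of \<open>v\<close>, and consider a marked
  vertex \<open>m\<close> outside \<open>S\<close> that is not marked by an element of \<open>S\<close>. Let \<open>R m\<close> consist of the neighbors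
  of \<open>m\<close> in \<open>S\<close> and the \<open>\<sigma> u\<close> for the other neighbors \<open>u\<close> of \<open>m\<close>.

  If \<open>R m\<close> has at least three elements, contract each \<open>u\<close> into \<open>\<sigma> u\<close>: Euler's bound for the resulting
  bipartite planar graph leaves at most \<open>2 * card S\<close> such \<open>m\<close> in any independent set, and an
  independent set contains a quarter of them, since triangle-free planar graphs have vertices of
  degree at most three. This gives \<open>8 * card S\<close>.

  Otherwise let \<open>v \<notin> S\<close> mark \<open>m\<close> and put \<open>s = \<sigma> v\<close>. Without triangles, \<open>R m = {\<sigma> m, s}\<close> and all
  neighbors of \<open>m\<close> except \<open>\<sigma> m\<close> are neighbors of \<open>s\<close>; as the degree of \<open>m\<close> is at least that of \<open>s\<close>,
  \<open>m\<close> shares all but one of the neighbors of \<open>s\<close>. Since a planar graph contains no \<open>K\<^sub>3\<^sub>,\<^sub>3\<close>, every \<open>s\<close>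
  has at most four such \<open>m\<close>. In total at most \<open>(1 + 1 + 8 + 4) * card S\<close> vertices are marked.

  Euler's bound for topological drawings comes from the Jordan curve theorem, by which an edge closing a
  cycle creates a new face, and from Janiszewski's theorem, by which an edge borders at most two faces
  and a forest does not separate the plane.\<close>

section \<open>Adding an arc to a compact set in the plane\<close>

lemma open_complement_component:
  fixes K :: "complex set"
  assumes "compact K" "C \<in> components (- K)"
  shows "open C"
  using open_components[OF _ assms(2)] compact_imp_closed[OF assms(1)] by (simp add: open_Compl)

lemma components_eqI:
  assumes "C \<in> components S" "C' \<in> components S" "x \<in> C" "x \<in> C'"
  shows "C = C'"
  using assms components_eq by blast

lemma component_of_remove:
  assumes "C \<in> components S" "C \<subseteq> T" "T \<subseteq> S"
  shows "C \<in> components T"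
  using assms(1,2) subset_trans[OF _ assms(3)] unfolding in_components_maximal by simp

text \<open>Without its ends the arc is still connected and misses \<open>K\<close>. So
  \<open>f\<close> is the face across which the new edge is drawn.\<close>

lemma arc_interior_component:
  fixes \<gamma> :: "real \<Rightarrow> complex"
  assumes "arc \<gamma>" "path_image \<gamma> \<inter> K = {pathstart \<gamma>, pathfinish \<gamma>}"
  obtains f where "f \<in> components (- K)" "path_image \<gamma> - {pathstart \<gamma>, pathfinish \<gamma>} \<subseteq> f"
    "path_image \<gamma> - {pathstart \<gamma>, pathfinish \<gamma>} \<noteq> {}"
proof -
  let ?I = "path_image \<gamma> - {pathstart \<gamma>, pathfinish \<gamma>}"
  have c: "connected ?I" and n: "?I \<noteq> {}"
    using assms(1) arc_imp_simple_path connected_simple_path_endless nonempty_simple_path_endless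
    by blast+
  have "?I \<subseteq> - K" using assms(2) by blast
  then obtain f where "f \<in> components (- K)" "?I \<subseteq> f"
    using exists_component_superset[OF _ _ c, of "- K"] n by blast
  then show thesis using that n by blast
qed

text \<open>A path in \<open>K\<close> between the ends contains an arc, which together with
  \<open>\<gamma>\<close> forms a Jordan curve. This curve meets \<open>K\<close> exactly in that
  second arc; the connectedness is recorded for Janiszewski's theorem.\<close>

lemma closing_curve:
  fixes \<gamma> :: "real \<Rightarrow> complex"
  assumes "arc \<gamma>" "path_image \<gamma> \<inter> K = {pathstart \<gamma>, pathfinish \<gamma>}"
    and "path_component K (pathstart \<gamma>) (pathfinish \<gamma>)"
  obtains c where "simple_path c" "pathfinish c = pathstart c" "path_image \<gamma> \<subseteq> path_image c"
    "path_image c \<subseteq> path_image \<gamma> \<union> K" "connected (path_image c \<inter> K)"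
proof -
  have ne: "pathstart \<gamma> \<noteq> pathfinish \<gamma>"
    using assms(1) arc_distinct_ends by metis
  obtain p where p: "path p" "path_image p \<subseteq> K" "pathstart p = pathfinish \<gamma>"
      "pathfinish p = pathstart \<gamma>"
    using path_component_sym[OF assms(3)] unfolding path_component_def by blast
  obtain q where q: "arc q" "path_image q \<subseteq> K" "pathstart q = pathfinish \<gamma>"
      "pathfinish q = pathstart \<gamma>"
    using path_contains_arc[OF p(1,3,4)] ne p(2) by (metis subset_trans)
  have sub: "path_image \<gamma> \<inter> path_image q \<subseteq> {pathstart \<gamma>, pathstart q}"
    using assms(2) q(2,3) by auto
  have im: "path_image (\<gamma> +++ q) = path_image \<gamma> \<union> path_image q"
    using q(3) by (simp add: path_image_join)
  show thesis
  proof
    show "simple_path (\<gamma> +++ q)"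
      using simple_path_join_loop[OF assms(1) q(1)] q sub by simp
    have "path_image (\<gamma> +++ q) \<inter> K = path_image q"
      using assms(2) q unfolding im
      by (metis (no_types, lifting) Int_Un_distrib2 inf.absorb1 insert_subset bot.extremum
          le_iff_sup pathfinish_in_path_image pathstart_in_path_image)
    then show "connected (path_image (\<gamma> +++ q) \<inter> K)"
      using q(1) connected_arc_image by simp
  qed (use q im in auto)
qed

text \<open>Such a face would be the whole arc without its ends, which would then be open. Together
  with the open complement of the arc it would disconnect the plane minus two points.\<close>

lemma open_subset_arc_empty:
  fixes \<gamma> :: "real \<Rightarrow> complex"
  assumes "arc \<gamma>" "f \<in> components (- K)" "compact K"
    and "path_image \<gamma> \<inter> K = {pathstart \<gamma>, pathfinish \<gamma>}"
  shows "\<not> f \<subseteq> path_image \<gamma>"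
proof
  let ?I = "path_image \<gamma> - {pathstart \<gamma>, pathfinish \<gamma>}"
  assume f: "f \<subseteq> path_image \<gamma>"
  obtain g where g: "g \<in> components (- K)" "?I \<subseteq> g" "?I \<noteq> {}"
    using arc_interior_component[OF assms(1,4)] .
  have fI: "f \<subseteq> ?I"
    using f assms(2,4) in_components_subset by blast
  then have "f = g"
    using components_eqI[OF assms(2) g(1)] g(2) in_components_nonempty[OF assms(2)] by blast
  then have fe: "f = ?I" using g fI by blast
  have o: "open ?I" using open_complement_component[OF assms(3,2)] fe by simp
  have o2: "open (- path_image \<gamma>)" using assms(1) closed_arc_image by blast
  have ne: "- path_image \<gamma> \<noteq> {}"
    using bounded_arc_image[OF assms(1)] not_bounded_UNIV by (metis Compl_empty_eq double_complement)
  have "connected (UNIV - {pathstart \<gamma>, pathfinish \<gamma>})"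
    by (rule connected_open_delete_finite) auto
  moreover have "UNIV - {pathstart \<gamma>, pathfinish \<gamma>} \<subseteq> ?I \<union> - path_image \<gamma>" by blast
  ultimately show False
    using connectedD[OF _ o o2] ne g(3) by fastforce
qed

text \<open>Only the face \<open>f\<close> crossed by the arc is lost. It leaves at least one new
  face, and at least two if the arc closes a Jordan curve. Working with a finite family
  \<open>F\<close> avoids proving that there are finitely many faces.\<close>

lemma more_components_after_adding_arc:
  fixes \<gamma> :: "real \<Rightarrow> complex"
  assumes "compact K" "arc \<gamma>" "path_image \<gamma> \<inter> K = {pathstart \<gamma>, pathfinish \<gamma>}"
    and F: "F \<subseteq> components (- K)" "finite F"
  obtains F' where "F' \<subseteq> components (- (K \<union> path_image \<gamma>))" "finite F'" "card F \<le> card F'"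
    "path_component K (pathstart \<gamma>) (pathfinish \<gamma>) \<Longrightarrow> Suc (card F) \<le> card F'"
proof -
  let ?I = "path_image \<gamma> - {pathstart \<gamma>, pathfinish \<gamma>}"
  let ?S = "- (K \<union> path_image \<gamma>)"
  obtain f where f: "f \<in> components (- K)" "?I \<subseteq> f" "?I \<noteq> {}"
    using arc_interior_component[OF assms(2,3)] .
  have keep: "C \<in> components ?S" if "C \<in> F" "C \<noteq> f" for C
  proof (rule component_of_remove)
    show "C \<in> components (- K)" using that F by blast
    then have "C \<inter> f = {}" "C \<subseteq> - K"
      using that f(1) components_nonoverlap in_components_subset by blast+
    then show "C \<subseteq> ?S" using f(2) assms(3) by blast
  qed auto
  have sub: "F - {f} \<subseteq> components ?S" using keep by blast
  have cF: "card F \<le> Suc (card (F - {f}))"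
    using card_Suc_Diff1[OF F(2), of f] by (cases "f \<in> F") auto
  \<comment> \<open>The component of a point of \<open>f\<close> off the arc is new: it differs from
    \<open>f\<close>, since it misses the arc, and from the other members of \<open>F\<close>, since
    they are disjoint from \<open>f\<close>.\<close>
  have new: "connected_component_set ?S x \<in> components ?S - F" "x \<in> connected_component_set ?S x"
    if "x \<in> f" "x \<notin> path_image \<gamma>" for x
  proof -
    have xS: "x \<in> ?S" using that f(1) in_components_subset by blast
    show xc: "x \<in> connected_component_set ?S x" using xS by simp
    have "connected_component_set ?S x \<noteq> C" if "C \<in> F" for C
    proof (cases "C = f")
      case True
      then show ?thesis
        using f(2,3) connected_component_subset[of ?S x] by blast
    next
      case False
      then have "C \<inter> f = {}" using that f(1) F(1) components_nonoverlap by blast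
      then show ?thesis using xc \<open>x \<in> f\<close> by blast
    qed
    then show "connected_component_set ?S x \<in> components ?S - F"
      using componentsI[OF xS] by blast
  qed
  show thesis
  proof (cases "path_component K (pathstart \<gamma>) (pathfinish \<gamma>)")
    case True
    obtain c where c: "simple_path c" "pathfinish c = pathstart c" "path_image \<gamma> \<subseteq> path_image c"
        "path_image c \<subseteq> path_image \<gamma> \<union> K"
      using closing_curve[OF assms(2,3) True] by metis
    note J = Jordan_inside_outside[OF c(1,2)]
    obtain x where x: "x \<in> ?I" using f(3) by blast
    have xf: "x \<in> f" "open f" using x f open_complement_component[OF assms(1)] by auto
    \<comment> \<open>Every point of a Jordan curve borders both of its sides, so the open set
      \<open>f\<close> around \<open>x\<close> has points on each side.\<close>
    have "x \<in> frontier (inside (path_image c))" "x \<in> frontier (outside (path_image c))"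
      using J x c(3) by auto
    then have "f \<inter> inside (path_image c) \<noteq> {}" "f \<inter> outside (path_image c) \<noteq> {}"
      using xf open_Int_closure_eq_empty[OF xf(2)] unfolding frontier_def by blast+
    then obtain p q where p: "p \<in> f" "p \<in> inside (path_image c)"
        and q: "q \<in> f" "q \<in> outside (path_image c)" by blast
    have pq: "p \<notin> path_image \<gamma>" "q \<notin> path_image \<gamma>"
      using p q c(3) J by blast+
    let ?P = "connected_component_set ?S p" and ?Q = "connected_component_set ?S q"
    have "?P \<noteq> ?Q"
    proof
      assume "?P = ?Q"
      then have "p \<in> ?Q" "q \<in> ?Q" using new p q pq by blast+
      moreover have "?Q \<subseteq> inside (path_image c) \<union> outside (path_image c)"
        using connected_component_subset[of ?S q] c(4) J by blast
      ultimately show False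
        using connectedD[OF connected_connected_component[of ?S q], of "inside (path_image c)" "outside (path_image c)"]
          J p q by blast
    qed
    then have "card (insert ?P (insert ?Q (F - {f}))) = Suc (Suc (card (F - {f})))"
      using F(2) new(1)[OF p(1) pq(1)] new(1)[OF q(1) pq(2)] by simp
    then show thesis
      using that[of "insert ?P (insert ?Q (F - {f}))"] sub F(2) cF
        new(1)[OF p(1) pq(1)] new(1)[OF q(1) pq(2)] by simp
  next
    case False
    obtain p where p: "p \<in> f" "p \<notin> path_image \<gamma>"
      using open_subset_arc_empty[OF assms(2) f(1) assms(1,3)] by blast
    let ?P = "connected_component_set ?S p"
    have "card (insert ?P (F - {f})) = Suc (card (F - {f}))"
      using F(2) new(1)[OF p] by simp
    then show thesis
      using that[of "insert ?P (F - {f})"] sub F(2) cF new(1)[OF p] False by simp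
  qed
qed

section \<open>Faces that border an added arc\<close>

lemma component_meeting_arc:
  fixes \<gamma> :: "real \<Rightarrow> complex"
  assumes "compact K" "arc \<gamma>" "f \<in> components (- K)"
      "path_image \<gamma> - {pathstart \<gamma>, pathfinish \<gamma>} \<subseteq> f"
    and "g \<in> components (- (K \<union> path_image \<gamma>))"
      "frontier g \<inter> (path_image \<gamma> - {pathstart \<gamma>, pathfinish \<gamma>}) \<noteq> {}"
  shows "g \<subseteq> f"
proof (rule components_maximal[OF assms(3) in_components_connected[OF assms(5)]])
  show "g \<subseteq> - K" using in_components_subset[OF assms(5)] by blast
  have "open f" using open_complement_component assms by blast
  then show "f \<inter> g \<noteq> {}"
    using assms(4,6) open_Int_closure_eq_empty[of f g] unfolding frontier_def by blast
qed

text \<open>Janiszewski's theorem for the curve \<open>c\<close> and \<open>K\<close>: two points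
  separated by neither set are not separated by their union, because the intersection is connected.
  That union is \<open>K\<close> with the arc.\<close>

lemma component_same_side:
  fixes K :: "complex set"
  assumes "compact K" "arc \<gamma>" "simple_path c" "path_image \<gamma> \<subseteq> path_image c"
    "path_image c \<subseteq> path_image \<gamma> \<union> K" "connected (path_image c \<inter> K)"
    and f: "f \<in> components (- K)" "g \<in> components (- (K \<union> path_image \<gamma>))"
      "h \<in> components (- (K \<union> path_image \<gamma>))" "g \<subseteq> f" "h \<subseteq> f"
    and side: "connected s" "s \<subseteq> - path_image c" "s \<inter> g \<noteq> {}" "s \<inter> h \<noteq> {}"
  shows "g = h"
proof -
  obtain p q where p: "p \<in> s" "p \<in> g" and q: "q \<in> s" "q \<in> h" using side by blast
  have "connected_component (- (path_image c \<union> K)) p q"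
  proof (rule Janiszewski[OF _ _ assms(6)])
    show "connected_component (- path_image c) p q"
      using side p q unfolding connected_component_def by blast
    show "connected_component (- K) p q"
      using f p q in_components_connected[OF f(1)] in_components_subset[OF f(1)]
      unfolding connected_component_def by blast
  qed (use assms in \<open>auto simp: compact_simple_path_image compact_imp_closed\<close>)
  moreover have "path_image c \<union> K = K \<union> path_image \<gamma>" using assms(4,5) by blast
  ultimately obtain T where T: "connected T" "T \<subseteq> - (K \<union> path_image \<gamma>)" "p \<in> T" "q \<in> T"
    unfolding connected_component_def by auto
  have "T \<subseteq> g" "T \<subseteq> h"
    using components_maximal[OF f(2) T(1,2)] components_maximal[OF f(3) T(1,2)] T p q by blast+
  then show ?thesis using components_eqI[OF f(2,3)] T by blast
qed

text \<open>All faces that border the arc arise from the same face of \<open>K\<close>. Two of them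
  that meet the same side of the closing Jordan curve coincide, and there are two sides.\<close>

lemma arc_two_sides:
  fixes K :: "complex set"
  assumes "compact K" "arc \<gamma>" "path_image \<gamma> \<inter> K = {pathstart \<gamma>, pathfinish \<gamma>}"
    and "path_component K (pathstart \<gamma>) (pathfinish \<gamma>)"
  obtains g h where "\<And>f. f \<in> components (- (K \<union> path_image \<gamma>)) \<Longrightarrow>
      frontier f \<inter> (path_image \<gamma> - {pathstart \<gamma>, pathfinish \<gamma>}) \<noteq> {} \<Longrightarrow> f = g \<or> f = h"
proof -
  let ?I = "path_image \<gamma> - {pathstart \<gamma>, pathfinish \<gamma>}"
  let ?G = "{f \<in> components (- (K \<union> path_image \<gamma>)). frontier f \<inter> ?I \<noteq> {}}"
  obtain e where e: "e \<in> components (- K)" "?I \<subseteq> e" "?I \<noteq> {}"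
    using arc_interior_component[OF assms(2,3)] .
  obtain c where c: "simple_path c" "pathfinish c = pathstart c" "path_image \<gamma> \<subseteq> path_image c"
      "path_image c \<subseteq> path_image \<gamma> \<union> K" "connected (path_image c \<inter> K)"
    using closing_curve[OF assms(2,3,4)] by metis
  have J: "inside (path_image c) \<union> outside (path_image c) = - path_image c"
      "connected (inside (path_image c))" "connected (outside (path_image c))"
    using Jordan_inside_outside[OF c(1,2)] by simp_all
  have J': "inside (path_image c) \<subseteq> - path_image c" "outside (path_image c) \<subseteq> - path_image c"
    using J(1) by blast+
  have same: "f = f'" if "f \<in> ?G" "f' \<in> ?G" "connected s" "s \<subseteq> - path_image c"
      "s \<inter> f \<noteq> {}" "s \<inter> f' \<noteq> {}" for f f' s
    using component_same_side[OF assms(1,2) c(1,3,4,5) e(1), of f f' s]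
      component_meeting_arc[OF assms(1,2) e(1,2)] that by blast
  have side: "inside (path_image c) \<inter> f \<noteq> {} \<or> outside (path_image c) \<inter> f \<noteq> {}"
    if "f \<in> ?G" for f
  proof -
    have "f \<subseteq> - path_image c" "f \<noteq> {}"
      using that c(4) in_components_subset in_components_nonempty by blast+
    then show ?thesis using J(1) by blast
  qed
  \<comment> \<open>One representative is chosen for each side. If no bordering face meets a side,
    the value is arbitrary and harmless.\<close>
  define g where "g = (SOME f. f \<in> ?G \<and> inside (path_image c) \<inter> f \<noteq> {})"
  define h where "h = (SOME f. f \<in> ?G \<and> outside (path_image c) \<inter> f \<noteq> {})"
  have "f = g \<or> f = h" if f: "f \<in> ?G" for f
  proof (cases "inside (path_image c) \<inter> f \<noteq> {}")
    case True
    then have "g \<in> ?G \<and> inside (path_image c) \<inter> g \<noteq> {}"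
      using someI[of "\<lambda>f. f \<in> ?G \<and> inside (path_image c) \<inter> f \<noteq> {}" f] f unfolding g_def by blast
    then show ?thesis using same[OF f _ J(2) J'(1) True, of g] by blast
  next
    case False
    then have *: "outside (path_image c) \<inter> f \<noteq> {}" using side f by blast
    then have "h \<in> ?G \<and> outside (path_image c) \<inter> h \<noteq> {}"
      using someI[of "\<lambda>f. f \<in> ?G \<and> outside (path_image c) \<inter> f \<noteq> {}" f] f unfolding h_def by blast
    then show ?thesis using same[OF f _ J(3) J'(2) *, of h] by blast
  qed
  then show thesis using that[of g h] by blast
qed

text \<open>The case of an edge whose removal disconnects its ends. Janiszewski's theorem applies
  twice, first to \<open>K\<close> and the arc, then to their union and \<open>L\<close>; each time
  the two sets meet in a single point.\<close>

lemma bridge_one_side: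
  fixes K L :: "complex set"
  assumes "compact K" "compact L" "K \<inter> L = {}" "arc \<gamma>"
    and "path_image \<gamma> \<inter> K = {pathstart \<gamma>}" "path_image \<gamma> \<inter> L = {pathfinish \<gamma>}"
    and g: "g \<in> components (- (K \<union> L \<union> path_image \<gamma>))"
      "frontier g \<inter> (path_image \<gamma> - {pathstart \<gamma>, pathfinish \<gamma>}) \<noteq> {}"
    and h: "h \<in> components (- (K \<union> L \<union> path_image \<gamma>))"
      "frontier h \<inter> (path_image \<gamma> - {pathstart \<gamma>, pathfinish \<gamma>}) \<noteq> {}"
  shows "g = h"
proof -
  have KL: "compact (K \<union> L)" using assms by blast
  have "path_image \<gamma> \<inter> (K \<union> L) = {pathstart \<gamma>, pathfinish \<gamma>}" using assms(5,6) by blast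
  then obtain e where e: "e \<in> components (- (K \<union> L))"
      "path_image \<gamma> - {pathstart \<gamma>, pathfinish \<gamma>} \<subseteq> e"
    using arc_interior_component[OF assms(4)] by metis
  have sub: "g \<subseteq> e" "h \<subseteq> e"
    using component_meeting_arc[OF KL assms(4) e] g h by blast+
  obtain p q where p: "p \<in> g" and q: "q \<in> h" using g h in_components_nonempty by blast
  have pq: "connected_component (- (K \<union> L)) p q"
    using e(1) p q sub in_components_connected[OF e(1)] in_components_subset[OF e(1)]
    unfolding connected_component_def by blast
  have pq\<gamma>: "connected_component (- path_image \<gamma>) p q"
  proof -
    have "connected (- path_image \<gamma>)" by (rule connected_arc_complement[OF assms(4)]) simp
    moreover have "p \<notin> path_image \<gamma>" "q \<notin> path_image \<gamma>"
      using p q g(1) h(1) in_components_subset by blast+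
    ultimately show ?thesis by (auto simp: connected_component_def)
  qed
  have pK: "connected_component (- K) p q" and pL: "connected_component (- L) p q"
    using connected_component_mono[OF Compl_anti_mono[OF Un_upper1]]
      connected_component_mono[OF Compl_anti_mono[OF Un_upper2]] pq by blast+
  have cl: "closed (path_image \<gamma>)" "compact (path_image \<gamma>)" "closed L"
    using assms(2,4) closed_arc_image compact_arc_image compact_imp_closed by blast+
  have "K \<inter> path_image \<gamma> = {pathstart \<gamma>}" using assms(5) by blast
  then have 1: "connected_component (- (K \<union> path_image \<gamma>)) p q"
    using Janiszewski[OF assms(1) cl(1) _ pK pq\<gamma>] by simp
  have 2: "(K \<union> path_image \<gamma>) \<inter> L = {pathfinish \<gamma>}" using assms(3,6) by blast
  have "connected_component (- ((K \<union> path_image \<gamma>) \<union> L)) p q"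
    using Janiszewski[OF _ cl(3) _ 1 pL] compact_Un[OF assms(1) cl(2)] 2 by simp
  moreover have "(K \<union> path_image \<gamma>) \<union> L = K \<union> L \<union> path_image \<gamma>" by blast
  ultimately obtain T where T: "connected T" "T \<subseteq> - (K \<union> L \<union> path_image \<gamma>)" "p \<in> T" "q \<in> T"
    unfolding connected_component_def by auto
  have "T \<subseteq> g" "T \<subseteq> h"
    using components_maximal[OF g(1) T(1,2)] components_maximal[OF h(1) T(1,2)] T p q by blast+
  then show ?thesis using components_eqI[OF g(1) h(1)] T by blast
qed

section \<open>Euler's bound for plane graphs\<close>

text \<open>The vertices are included separately, so that the induction on the edges can start from
  the bare vertex set.\<close>

definition drawing :: "'a set \<Rightarrow> 'a set set \<Rightarrow> ('a \<Rightarrow> complex) \<Rightarrow> ('a set \<Rightarrow> real \<Rightarrow> complex) \<Rightarrow> complex set"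
  where "drawing V E pos crv = pos ` V \<union> (\<Union>e\<in>E. path_image (crv e))"

text \<open>Acyclicity, stated without cycles.\<close>

definition forest :: "'a set set \<Rightarrow> bool" where
  "forest E \<longleftrightarrow> (\<forall>B\<subseteq>E. B \<noteq> {} \<longrightarrow> (\<exists>v. card {e \<in> B. v \<in> e} = 1))"

section \<open>Elementary facts on graphs and their drawings\<close>

lemma forest_subset: "forest E \<Longrightarrow> B \<subseteq> E \<Longrightarrow> forest B"
  unfolding forest_def by (meson subset_trans)

lemma simple_graph_subset: "simple_graph V E \<Longrightarrow> B \<subseteq> E \<Longrightarrow> simple_graph V B"
  unfolding simple_graph_def by blast

lemma simple_graph_finite:
  assumes "simple_graph V E"
  shows "finite V" "finite E"
proof -
  show V: "finite V" using assms unfolding simple_graph_def by simp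
  have "E \<subseteq> Pow V" using assms unfolding simple_graph_def by blast
  then show "finite E" using V finite_subset by blast
qed

lemma simple_graph_edge:
  assumes "simple_graph V E" "{a, b} \<in> E"
  shows "a \<in> V" "b \<in> V" "a \<noteq> b"
proof -
  have "card {a, b} = 2" "{a, b} \<subseteq> V" using assms unfolding simple_graph_def by auto
  then show "a \<in> V" "b \<in> V" "a \<noteq> b" by auto
qed

lemma plane_drawing_subset:
  assumes "plane_drawing V E pos crv" "W \<subseteq> V" "B \<subseteq> E"
  shows "plane_drawing W B pos crv"
proof -
  have "inj_on pos W" using assms(1,2) inj_on_subset unfolding plane_drawing_def by metis
  moreover have "\<forall>e\<in>B. \<forall>v\<in>W. pos v \<in> path_image (crv e) \<longrightarrow> v \<in> e"
    using assms unfolding plane_drawing_def by (simp add: subset_iff)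
  moreover have "\<forall>e\<in>B. arc (crv e) \<and> {pathstart (crv e), pathfinish (crv e)} = pos ` e"
    using assms(1) subsetD[OF assms(3)] unfolding plane_drawing_def by meson
  moreover have "\<forall>e\<in>B. \<forall>f\<in>B. e \<noteq> f \<longrightarrow> path_image (crv e) \<inter> path_image (crv f) \<subseteq> pos ` (e \<inter> f)"
    using assms(1) subsetD[OF assms(3)] unfolding plane_drawing_def by meson
  ultimately show ?thesis unfolding plane_drawing_def by simp
qed

lemma plane_drawing_edge_ends:
  assumes "plane_drawing V E pos crv" "simple_graph V E" "e \<in> E"
  obtains a b where "e = {a, b}" "a \<noteq> b" "a \<in> V" "b \<in> V" "arc (crv e)"
    "pathstart (crv e) = pos a" "pathfinish (crv e) = pos b"
proof -
  obtain a b where ab: "e = {a, b}" "a \<noteq> b"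
    using assms(2,3) card_2_iff unfolding simple_graph_def by metis
  have V: "a \<in> V" "b \<in> V" using assms(2,3) ab unfolding simple_graph_def by auto
  have "arc (crv e)" "{pathstart (crv e), pathfinish (crv e)} = {pos a, pos b}"
    using assms(1,3) ab unfolding plane_drawing_def by auto
  then show thesis
    using that[of a b] that[of b a] ab V unfolding doubleton_eq_iff by (metis insert_commute)
qed

lemma compact_drawing:
  assumes "plane_drawing V E pos crv" "simple_graph V E"
  shows "compact (drawing V E pos crv)"
proof -
  have "\<And>e. e \<in> E \<Longrightarrow> arc (crv e)" using assms(1) unfolding plane_drawing_def by simp
  then show ?thesis
    using simple_graph_finite[OF assms(2)] unfolding drawing_def
    by (intro compact_Un compact_UN finite_imp_compact finite_imageI compact_arc_image)
qed

text \<open>This is the hypothesis of the lemmas on added arcs, with the drawing of the other edges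
  as the compact set.\<close>

lemma plane_drawing_new_edge:
  assumes "plane_drawing V E pos crv" "simple_graph V E" "e \<in> E"
  shows "path_image (crv e) \<inter> drawing V (E - {e}) pos crv = {pathstart (crv e), pathfinish (crv e)}"
proof -
  have pe: "{pathstart (crv e), pathfinish (crv e)} = pos ` e" and eV: "e \<subseteq> V"
    using assms unfolding plane_drawing_def simple_graph_def by auto
  have "path_image (crv e) \<inter> drawing V (E - {e}) pos crv \<subseteq> pos ` e"
  proof
    fix x assume x: "x \<in> path_image (crv e) \<inter> drawing V (E - {e}) pos crv"
    then consider v where "v \<in> V" "x = pos v"
      | f where "f \<in> E" "f \<noteq> e" "x \<in> path_image (crv f)"
      unfolding drawing_def by auto
    then show "x \<in> pos ` e"
    proof cases
      case 1
      then have "v \<in> e" using x assms(1,3) unfolding plane_drawing_def by auto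
      then show ?thesis using 1 by blast
    next
      case 2
      then have "path_image (crv e) \<inter> path_image (crv f) \<subseteq> pos ` (e \<inter> f)"
        using assms(1,3) unfolding plane_drawing_def by metis
      then show ?thesis using 2 x by blast
    qed
  qed
  moreover have "pos ` e \<subseteq> path_image (crv e)"
    unfolding pe[symmetric] by (simp add: pathstart_in_path_image pathfinish_in_path_image)
  moreover have "pos ` e \<subseteq> drawing V (E - {e}) pos crv"
    using image_mono[OF eV, of pos] unfolding drawing_def by (rule le_supI1)
  ultimately show ?thesis unfolding pe by (intro subset_antisym Int_greatest)
qed

lemma drawing_remove_edge:
  assumes "e \<in> E"
  shows "drawing V E pos crv = drawing V (E - {e}) pos crv \<union> path_image (crv e)"
proof -
  have "(\<Union>f\<in>insert e (E - {e}). path_image (crv f)) = path_image (crv e) \<union> (\<Union>f\<in>E - {e}. path_image (crv f))"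
    by (rule UN_insert)
  then show ?thesis unfolding drawing_def insert_Diff[OF assms] by (simp only: Un_ac)
qed

lemma path_component_edge:
  assumes "plane_drawing V E pos crv" "simple_graph V E" "e \<in> E" "u \<in> e" "v \<in> e"
  shows "path_component (drawing V E pos crv) (pos u) (pos v)"
proof -
  have a: "arc (crv e)" "{pathstart (crv e), pathfinish (crv e)} = pos ` e"
    using assms(1,3) unfolding plane_drawing_def by auto
  have "pos u \<in> path_image (crv e)" "pos v \<in> path_image (crv e)"
    using imageI[OF assms(4), of pos] imageI[OF assms(5), of pos] unfolding a(2)[symmetric] by auto
  then have "path_component (path_image (crv e)) (pos u) (pos v)"
    using path_connected_path_image[OF arc_imp_path[OF a(1)]] path_connected_component by blast
  moreover have "path_image (crv e) \<subseteq> drawing V E pos crv"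
    using assms(3) unfolding drawing_def by blast
  ultimately show ?thesis using path_component_of_subset by blast
qed

text \<open>The lower bound in Euler's formula. The map \<open>g\<close> labels the vertices by (at least) the
  connected components of the graph.\<close>

lemma many_faces_labelled:
  assumes "finite E" "plane_drawing V E pos crv" "simple_graph V E"
  shows "\<exists>F (g :: 'a \<Rightarrow> 'a). F \<subseteq> components (- drawing V E pos crv) \<and> finite F \<and>
    card E + 1 + card (g ` V) \<le> card F + card V \<and>
    (\<forall>u\<in>V. \<forall>v\<in>V. g u = g v \<longrightarrow> path_component (drawing V E pos crv) (pos u) (pos v))"
  using assms
proof (induction E)
  case empty
  have fin: "finite (pos ` V)" using empty simple_graph_finite(1) by blast
  have "connected (UNIV - pos ` V)"
    by (rule connected_open_delete_finite) (use fin in auto)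
  moreover have "- pos ` V \<noteq> {}"
    using fin infinite_UNIV_char_0[where 'a=complex] by (metis Compl_empty_eq double_complement)
  ultimately have "components (- pos ` V) = {- pos ` V}"
    by (simp add: components_eq_sing_iff Compl_eq_Diff_UNIV)
  moreover have "path_component (pos ` V) (pos v) (pos v)" if "v \<in> V" for v
    using that by (simp add: path_component_refl)
  \<comment> \<open>The complement of finitely many points is a single face, and the identity gives
    each vertex its own label.\<close>
  ultimately show ?case
    by (intro exI[of _ "{- pos ` V}"] exI[of _ id]) (auto simp: drawing_def)
next
  case (insert e E)
  let ?E = "insert e E" and ?D = "drawing V E pos crv"
  have E: "plane_drawing V E pos crv" "simple_graph V E"
    using plane_drawing_subset[OF insert.prems(1)] simple_graph_subset[OF insert.prems(2)] by blast+
  obtain F and g :: "'a \<Rightarrow> 'a" where F: "F \<subseteq> components (- ?D)" "finite F"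
      and c: "card E + 1 + card (g ` V) \<le> card F + card V"
      and g: "\<And>u v. u \<in> V \<Longrightarrow> v \<in> V \<Longrightarrow> g u = g v \<Longrightarrow> path_component ?D (pos u) (pos v)"
    using insert.IH[OF E] by blast
  have new: "path_image (crv e) \<inter> ?D = {pathstart (crv e), pathfinish (crv e)}"
    and D: "drawing V ?E pos crv = ?D \<union> path_image (crv e)"
    using plane_drawing_new_edge[OF insert.prems, of e] drawing_remove_edge[of e ?E] insert.hyps
    by auto
  obtain a b where ab: "e = {a, b}" "a \<noteq> b" "a \<in> V" "b \<in> V" "arc (crv e)"
    "pathstart (crv e) = pos a" "pathfinish (crv e) = pos b"
    using plane_drawing_edge_ends[OF insert.prems] by blast
  obtain F' where F': "F' \<subseteq> components (- drawing V ?E pos crv)" "finite F'" "card F \<le> card F'"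
    "path_component ?D (pos a) (pos b) \<Longrightarrow> Suc (card F) \<le> card F'"
    using more_components_after_adding_arc[OF compact_drawing[OF E] ab(5) new F] ab(6,7) D by metis
  have mono: "path_component (drawing V ?E pos crv) x y" if "path_component ?D x y" for x y
    using that D path_component_of_subset by blast
  have cE: "card ?E = Suc (card E)" using insert.hyps by simp
  have finV: "finite V" using E(2) simple_graph_finite by blast
  \<comment> \<open>If the ends have the same label, they are already joined and the edge adds a
    face. Otherwise no face is lost and two labels are merged. Either way the inequality survives
    the additional edge.\<close>
  show ?case
  proof (cases "g a = g b")
    case True
    then have "Suc (card F) \<le> card F'" using F'(4) g ab by blast
    then show ?thesis
      using F' c g mono cE by (intro exI[of _ F'] exI[of _ g]) auto
  next
    case False
    \<comment> \<open>The label of \<open>b\<close> is replaced by that of \<open>a\<close>;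
      vertices with the merged label are joined through the new edge.\<close>
    define h where "h = (\<lambda>u. if g u = g b then g a else g u)"
    have "h ` V \<subseteq> g ` V - {g b}" using False ab(3) unfolding h_def by auto
    then have "card (h ` V) \<le> card (g ` V) - 1"
      using card_mono[of "g ` V - {g b}" "h ` V"] finV ab(4) by (simp add: card_Diff_singleton)
    moreover have "0 < card (g ` V)" using finV ab(4) card_gt_0_iff by blast
    ultimately have "card ?E + 1 + card (h ` V) \<le> card F' + card V" using c cE F'(3) by linarith
    moreover have "path_component (drawing V ?E pos crv) (pos u) (pos v)"
      if uv: "u \<in> V" "v \<in> V" "h u = h v" for u v
    proof -
      have e: "path_component (drawing V ?E pos crv) (pos a) (pos b)"
        using path_component_edge[OF insert.prems, of e a b] ab(1) by blast
      have to_a: "path_component (drawing V ?E pos crv) (pos w) (pos a)"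
        if "w \<in> V" "h w = g a" for w
        using g[of w a] g[of w b] that ab(3,4) mono e path_component_sym path_component_trans
        unfolding h_def by (metis (full_types))
      show ?thesis
      proof (cases "h u = g a")
        case True
        then show ?thesis using to_a uv path_component_sym path_component_trans by metis
      next
        case False
        then have "g u = g v" using uv(3) unfolding h_def by (auto split: if_splits)
        then show ?thesis using g uv mono by blast
      qed
    qed
    ultimately show ?thesis using F'(1,2) by blast
  qed
qed

text \<open>A nonempty vertex set uses at least one label, which leaves the usual constant 2 of
  Euler's formula.\<close>

lemma many_faces:
  assumes "plane_drawing V E pos crv" "simple_graph V E" "V \<noteq> {}"
  obtains F where "F \<subseteq> components (- drawing V E pos crv)" "finite F" "card E + 2 \<le> card F + card V"
proof -
  obtain F and g :: "'a \<Rightarrow> 'a" where "F \<subseteq> components (- drawing V E pos crv)" "finite F"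
      "card E + 1 + card (g ` V) \<le> card F + card V"
    using many_faces_labelled[OF simple_graph_finite(2)[OF assms(2)] assms(1,2)] by blast
  moreover have "0 < card (g ` V)"
    using assms(3) simple_graph_finite(1)[OF assms(2)] by (simp add: card_gt_0_iff)
  ultimately show thesis using that[of F] by linarith
qed

text \<open>Two cases, according to whether the rest of the drawing joins the ends of
  \<open>e\<close>: then the edge has two sides, otherwise it is a bridge with one. Vertices are
  left out because many faces may meet at an end of the edge.\<close>

lemma edge_borders_two_faces:
  assumes "plane_drawing V E pos crv" "simple_graph V E" "e \<in> E"
    and F: "F \<subseteq> components (- drawing V E pos crv)"
  shows "card {f \<in> F. frontier f \<inter> (path_image (crv e) - pos ` V) \<noteq> {}} \<le> 2"
proof -
  let ?D = "drawing V (E - {e}) pos crv"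
  let ?I = "path_image (crv e) - {pathstart (crv e), pathfinish (crv e)}"
  let ?G = "{f \<in> F. frontier f \<inter> (path_image (crv e) - pos ` V) \<noteq> {}}"
  have E: "plane_drawing V (E - {e}) pos crv" "simple_graph V (E - {e})"
    using plane_drawing_subset[OF assms(1)] simple_graph_subset[OF assms(2)] by blast+
  have D: "drawing V E pos crv = ?D \<union> path_image (crv e)"
    using drawing_remove_edge[OF assms(3)] .
  note new = plane_drawing_new_edge[OF assms(1-3)]
  obtain a b where ab: "e = {a, b}" "a \<noteq> b" "a \<in> V" "b \<in> V" "arc (crv e)"
    "pathstart (crv e) = pos a" "pathfinish (crv e) = pos b"
    using plane_drawing_edge_ends[OF assms(1-3)] .
  have G: "f \<in> components (- (?D \<union> path_image (crv e)))" "frontier f \<inter> ?I \<noteq> {}" if "f \<in> ?G" for f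
    using that F D ab by auto
  have "\<exists>g h. ?G \<subseteq> {g, h}"
  proof (cases "path_component ?D (pos a) (pos b)")
    case True
    then obtain g h where "\<And>f. f \<in> components (- (?D \<union> path_image (crv e))) \<Longrightarrow>
        frontier f \<inter> ?I \<noteq> {} \<Longrightarrow> f = g \<or> f = h"
      using arc_two_sides[OF compact_drawing[OF E] ab(5) new] ab(6,7) by metis
    then have "?G \<subseteq> {g, h}" using G by blast
    then show ?thesis by blast
  next
    case False
    \<comment> \<open>For a bridge, \<open>X\<close> is the set of vertices still reachable from
      \<open>a\<close>. No remaining edge leaves \<open>X\<close>, so the rest splits into two
      disjoint drawings, one at each end of \<open>e\<close>.\<close>
    define X where "X = {v \<in> V. path_component ?D (pos a) (pos v)}"
    define EA where "EA = {f \<in> E - {e}. f \<inter> X \<noteq> {}}"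
    define EB where "EB = {f \<in> E - {e}. f \<inter> X = {}}"
    let ?K = "drawing X EA pos crv" and ?L = "drawing (V - X) EB pos crv"
    have EAX: "f \<subseteq> X" if fA: "f \<in> EA" for f
    proof
      fix v assume v: "v \<in> f"
      obtain x where x: "x \<in> f" "path_component ?D (pos a) (pos x)"
        using fA unfolding EA_def X_def by blast
      have f: "f \<in> E - {e}" using fA unfolding EA_def by blast
      then have "v \<in> V" using v E(2) unfolding simple_graph_def by blast
      then show "v \<in> X"
        using path_component_trans[OF x(2) path_component_edge[OF E f x(1) v]] unfolding X_def by blast
    qed
    have pv: "v \<in> f" if "v \<in> V" "f \<in> E" "pos v \<in> path_image (crv f)" for v f
      using that assms(1) unfolding plane_drawing_def by blast
    have pf: "path_image (crv f) \<inter> path_image (crv f') = {}"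
      if "f \<in> E" "f' \<in> E" "f \<inter> f' = {}" "f \<noteq> f'" for f f'
      using that assms(1) unfolding plane_drawing_def by (metis image_empty subset_empty)
    have inj: "inj_on pos V" and XV: "X \<subseteq> V"
      using assms(1) unfolding plane_drawing_def X_def by simp_all
    have KL0: "?K \<inter> ?L = {}"
    proof -
      have "pos ` X \<inter> pos ` (V - X) = {}" 
        using inj_on_image_Int[OF inj XV, of "V - X"] by auto
      moreover have "pos v \<notin> path_image (crv f)" if "v \<in> X" "f \<in> EB" for v f
        using pv[of v f] that unfolding EB_def X_def by auto
      moreover have "pos v \<notin> path_image (crv f)" if "v \<in> V - X" "f \<in> EA" for v f
        using pv[of v f] that EAX[of f] unfolding EA_def by auto
      moreover have "path_image (crv f) \<inter> path_image (crv f') = {}" if "f \<in> EA" "f' \<in> EB" for f f'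
      proof (rule pf)
        show "f \<inter> f' = {}" using that EAX unfolding EB_def by blast
        show "f \<noteq> f'" using that unfolding EA_def EB_def by blast
      qed (use that in \<open>auto simp: EA_def EB_def\<close>)
      ultimately show ?thesis unfolding drawing_def by (fastforce simp: disjoint_iff)
    qed
    have KL: "?K \<union> ?L = ?D" unfolding drawing_def EA_def EB_def X_def by blast
    have aK: "pos a \<in> ?K" and bL: "pos b \<in> ?L"
    proof -
      have "path_component ?D (pos a) (pos a)"
        using ab(3) by (intro path_component_refl) (simp add: drawing_def)
      then show "pos a \<in> ?K" using ab(3) by (simp add: drawing_def X_def)
      show "pos b \<in> ?L" using False ab(4) by (simp add: drawing_def X_def)
    qed
    have pK: "plane_drawing X EA pos crv" "simple_graph X EA"
    proof -
      show "plane_drawing X EA pos crv"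
        by (rule plane_drawing_subset[OF assms(1)]) (auto simp: X_def EA_def)
      have "finite X" using simple_graph_finite(1)[OF assms(2)] unfolding X_def by simp
      moreover have "card f = 2" if "f \<in> EA" for f
        using that assms(2) unfolding simple_graph_def EA_def by blast
      ultimately show "simple_graph X EA" using EAX unfolding simple_graph_def by blast
    qed
    have pL: "plane_drawing (V - X) EB pos crv" "simple_graph (V - X) EB"
    proof -
      show "plane_drawing (V - X) EB pos crv"
        by (rule plane_drawing_subset[OF assms(1)]) (auto simp: EB_def)
      show "simple_graph (V - X) EB"
        using assms(2) unfolding simple_graph_def EB_def by auto
    qed
    have iK: "path_image (crv e) \<inter> ?K = {pathstart (crv e)}"
      and iL: "path_image (crv e) \<inter> ?L = {pathfinish (crv e)}"
    proof -
      have "P \<inter> K = {x} \<and> P \<inter> L = {y}"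
        if "P \<inter> (K \<union> L) = {x, y}" "K \<inter> L = {}" "x \<in> K" "y \<in> L"
        for P K L :: "complex set" and x y
        using that by (auto simp: set_eq_iff)
      from this[OF _ KL0 aK bL, unfolded KL, OF new[unfolded ab(6,7)]]
      show "path_image (crv e) \<inter> ?K = {pathstart (crv e)}"
        "path_image (crv e) \<inter> ?L = {pathfinish (crv e)}"
        unfolding ab(6,7) by simp_all
    qed
    have same: "f = g" if fg: "f \<in> ?G" "g \<in> ?G" for f g
      using bridge_one_side[OF compact_drawing[OF pK] compact_drawing[OF pL] KL0 ab(5) iK iL,
          unfolded KL, OF G[OF fg(1)] G[OF fg(2)]] .
    show ?thesis
    proof (cases "?G = {}")
      case False
      then obtain f where f: "f \<in> ?G" by (metis ex_in_conv)
      have "?G \<subseteq> {f, f}"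
      proof
        fix x assume "x \<in> ?G"
        from same[OF this f] show "x \<in> {f, f}" by (simp only: insertI1)
      qed
      then show ?thesis by (intro exI)
    next
      case True
      then show ?thesis by (metis empty_subsetI)
    qed
  qed
  then obtain g h where "?G \<subseteq> {g, h}" by (elim exE)
  then have "card ?G \<le> card {g, h}" by (intro card_mono) auto
  also have "\<dots> \<le> 2" by (simp add: card_insert_if)
  finally show ?thesis .
qed

text \<open>Induction by removing a leaf edge. It meets the other edges in at most one point, its
  inner end, so by Janiszewski's theorem putting it back does not separate the plane.\<close>

lemma connected_complement_forest:
  assumes "finite B" "forest B" "plane_drawing V B pos crv" "simple_graph V B"
  shows "connected (- (\<Union>e\<in>B. path_image (crv e)))"
  using assms
proof (induction B rule: finite_psubset_induct)
  case (psubset B)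
  show ?case
  proof (cases "B = {}")
    case False
    then obtain v where "card {e \<in> B. v \<in> e} = 1"
      using psubset.prems(1) unfolding forest_def by blast
    then obtain e where e: "{e \<in> B. v \<in> e} = {e}" using card_1_singletonE by blast
    let ?B = "B - {e}"
    have eB: "e \<in> B" "v \<in> e" using e by blast+
    have IH: "connected (- (\<Union>e\<in>?B. path_image (crv e)))"
      using eB forest_subset[OF psubset.prems(1)] plane_drawing_subset[OF psubset.prems(2)]
        simple_graph_subset[OF psubset.prems(3)]
      by (intro psubset.IH) auto
    obtain a b where ab: "e = {a, b}" "arc (crv e)"
      using plane_drawing_edge_ends[OF psubset.prems(2,3) eB(1)] by metis
    then obtain w where w: "e = {v, w}" using eB by blast
    have "path_image (crv e) \<inter> path_image (crv f) \<subseteq> {pos w}" if "f \<in> ?B" for f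
    proof -
      have "path_image (crv e) \<inter> path_image (crv f) \<subseteq> pos ` (e \<inter> f)"
        using that eB(1) psubset.prems(2) unfolding plane_drawing_def by (metis Diff_iff insertI1)
      moreover have "v \<notin> f" using that e by blast
      ultimately show ?thesis using w by blast
    qed
    then have "path_image (crv e) \<inter> (\<Union>e\<in>?B. path_image (crv e)) \<subseteq> {pos w}" by blast
    then have "connected (path_image (crv e) \<inter> (\<Union>e\<in>?B. path_image (crv e)))"
      using subset_singletonD by fastforce
    moreover have "closed (\<Union>e\<in>?B. path_image (crv e))"
      using psubset.hyps psubset.prems(2) closed_arc_image unfolding plane_drawing_def
      by (intro closed_UN) auto
    moreover have "connected (- path_image (crv e))"
      by (rule connected_arc_complement[OF ab(2)]) simp
    ultimately have "connected (- (path_image (crv e) \<union> (\<Union>e\<in>?B. path_image (crv e))))"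
      using Janiszewski_connected[OF compact_arc_image[OF ab(2)] _ _ _ IH] by blast
    moreover have "path_image (crv e) \<union> (\<Union>e\<in>?B. path_image (crv e)) = (\<Union>e\<in>B. path_image (crv e))"
      using eB(1) by blast
    ultimately show ?thesis by simp
  next
    case True
    then show ?thesis using convex_connected[OF convex_UNIV] by simp
  qed
qed

text \<open>A face whose boundary contains no cycle is everything outside its boundary.\<close>

lemma face_with_forest_boundary_unique:
  assumes "plane_drawing V E pos crv" "simple_graph V E"
    and f: "f \<in> components (- drawing V E pos crv)" and g: "g \<in> components (- drawing V E pos crv)"
    and "forest {e \<in> E. frontier f \<inter> (path_image (crv e) - pos ` V) \<noteq> {}}"
  shows "g = f"
proof -
  let ?B = "{e \<in> E. frontier f \<inter> (path_image (crv e) - pos ` V) \<noteq> {}}"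
  have B: "plane_drawing V ?B pos crv" "simple_graph V ?B"
    by (rule plane_drawing_subset[OF assms(1)] simple_graph_subset[OF assms(2)]; blast)+
  let ?U = "\<Union>e\<in>?B. path_image (crv e)"
  \<comment> \<open>The boundary edges form a forest and do not separate the plane; deleting
    finitely many further points from a connected open set does not either.\<close>
  have "connected (- ?U - pos ` V)"
  proof (rule connected_open_delete_finite)
    have "compact ?U"
      using B(1) simple_graph_finite(2)[OF B(2)] compact_arc_image unfolding plane_drawing_def
      by (intro compact_UN) auto
    then show "open (- ?U)" using compact_imp_closed by blast
    show "connected (- ?U)"
      using connected_complement_forest[OF simple_graph_finite(2)[OF B(2)] assms(5) B] .
  qed (use simple_graph_finite(1)[OF assms(2)] in auto)
  moreover have "- ?U - pos ` V = - drawing V ?B pos crv" unfolding drawing_def by blast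
  ultimately have con: "connected (- drawing V ?B pos crv)" by metis
  have "frontier f \<subseteq> drawing V E pos crv"
    using frontier_of_components_closed_complement[OF compact_imp_closed f] compact_drawing[OF assms(1,2)]
    by blast
  then have "frontier f \<subseteq> drawing V ?B pos crv" unfolding drawing_def by blast
  moreover have le: "- drawing V E pos crv \<subseteq> - drawing V ?B pos crv" unfolding drawing_def by blast
  moreover have fs: "f \<subseteq> - drawing V E pos crv" "f \<noteq> {}"
    using f in_components_subset in_components_nonempty by blast+
  \<comment> \<open>This connected set meets \<open>f\<close> but not its frontier, hence stays
    inside \<open>f\<close>.\<close>
  ultimately have "- drawing V ?B pos crv \<subseteq> f"
    using connected_Int_frontier[OF con, of f] by blast
  then have "g \<subseteq> f" using in_components_subset[OF g] le by blast
  then show ?thesis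
    using components_eq[OF g f] in_components_nonempty[OF g] by blast
qed

text \<open>Euler's bound, with the cycle lengths measured by their number of edges in \<open>Q\<close>.\<close>

lemma plane_graph_edge_bound:
  assumes "plane_drawing V E pos crv" "simple_graph V E" "V \<noteq> {}" "Q \<subseteq> E"
    and Q: "\<And>B. B \<subseteq> E \<Longrightarrow> card (B \<inter> Q) \<le> 3 \<Longrightarrow> forest B"
  shows "card E < card V \<or> 2 * card E + 4 \<le> 2 * card V + card Q"
proof -
  obtain F where F: "F \<subseteq> components (- drawing V E pos crv)" "finite F"
      "card E + 2 \<le> card F + card V"
    using many_faces[OF assms(1-3)] .
  \<comment> \<open>With at most one face, the face count already gives
    \<open>card E < card V\<close>.\<close>
  show ?thesis
  proof (cases "card F \<le> 1")
    case False
    let ?R = "\<lambda>f e. frontier f \<inter> (path_image (crv e) - pos ` V) \<noteq> {}"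
    have finQ: "finite Q" using finite_subset[OF assms(4) simple_graph_finite(2)[OF assms(2)]] .
    \<comment> \<open>With fewer edges of \<open>Q\<close> on its boundary, that boundary would be a
      forest and \<open>f\<close> the only face.\<close>
    have "4 \<le> card {e \<in> Q. ?R f e}" if f: "f \<in> F" for f
    proof (rule ccontr)
      assume "\<not> 4 \<le> card {e \<in> Q. ?R f e}"
      moreover have "{e \<in> E. ?R f e} \<inter> Q = {e \<in> Q. ?R f e}" using assms(4) by blast
      ultimately have "forest {e \<in> E. ?R f e}" using Q[of "{e \<in> E. ?R f e}"] by simp
      then have "F \<subseteq> {f}"
        using face_with_forest_boundary_unique[OF assms(1,2)] f F(1) by blast
      then show False using False card_mono[of "{f}" F] by simp
    qed
    \<comment> \<open>Double counting of the incidences between faces and edges of \<open>Q\<close>: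
      at least four per face, at most two per edge.\<close>
    then have "4 * card F \<le> (\<Sum>f\<in>F. card {e \<in> Q. ?R f e})"
      using sum_bounded_below[of F 4 "\<lambda>f. card {e \<in> Q. ?R f e}"] by simp
    also have "\<dots> = (\<Sum>e\<in>Q. card {f \<in> F. ?R f e})"
      by (rule sum_multicount_gen) (use F(2) finQ in auto)
    also have "\<dots> \<le> card Q * 2"
      using sum_bounded_above[of Q "\<lambda>e. card {f \<in> F. ?R f e}" 2]
        edge_borders_two_faces[OF assms(1,2) _ F(1)] assms(4) by auto
    finally show ?thesis using F(3) by linarith
  qed (use F(3) in linarith)
qed

section \<open>Triangle-free and bipartite planar graphs\<close>

text \<open>A counterexample to \<open>forest\<close> is a nonempty edge set without leaves. This
  lemma follows such a set from one edge to the next.\<close>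

lemma second_edge_at_vertex:
  assumes "\<not> (\<exists>v. card {e \<in> C. v \<in> e} = 1)" "e \<in> C" "v \<in> e"
  obtains f where "f \<in> C" "v \<in> f" "f \<noteq> e"
proof -
  have "{e \<in> C. v \<in> e} \<noteq> {e}"
  proof
    assume "{e \<in> C. v \<in> e} = {e}"
    then have "card {e \<in> C. v \<in> e} = 1" by simp
    then show False using assms(1) by blast
  qed
  then show thesis using that assms(2,3) by blast
qed

text \<open>In a leafless set, the second edges at the two ends of an edge are distinct. These three
  edges exhaust the set, and the continuation at the far end \<open>x\<close> closes a
  triangle.\<close>

lemma forest_small_triangle_free:
  assumes "simple_graph V E" "triangle_free E" "B \<subseteq> E" "card B \<le> 3"
  shows "forest B"
  unfolding forest_def
proof (intro allI impI, rule ccontr)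
  fix C assume CB: "C \<subseteq> B" and ne: "C \<noteq> {}" and no: "\<not> (\<exists>v. card {e \<in> C. v \<in> e} = 1)"
  have fin: "finite B" using simple_graph_finite(2)[OF simple_graph_subset[OF assms(1,3)]] .
  have card2: "\<exists>w. f = {v, w} \<and> v \<noteq> w" if "f \<in> C" "v \<in> f" for f v
  proof -
    have "card f = 2" using that CB assms(1,3) unfolding simple_graph_def by blast
    then show ?thesis using that(2) unfolding card_2_iff by (metis insert_commute insert_iff singletonD)
  qed
  obtain e where e: "e \<in> C" using ne by blast
  then have "card e = 2" using CB assms(1,3) unfolding simple_graph_def by blast
  then obtain a b where ab: "e = {a, b}" "a \<noteq> b" unfolding card_2_iff by blast
  obtain e2 where e2: "e2 \<in> C" "a \<in> e2" "e2 \<noteq> e"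
    using second_edge_at_vertex[OF no e, of a] ab by blast
  obtain e3 where e3: "e3 \<in> C" "b \<in> e3" "e3 \<noteq> e"
    using second_edge_at_vertex[OF no e, of b] ab by blast
  obtain x where x: "e2 = {a, x}" "a \<noteq> x" using card2 e2 by blast
  obtain y where y: "e3 = {b, y}" "b \<noteq> y" using card2 e3 by blast
  have xb: "x \<noteq> b" and ya: "y \<noteq> a" using x y e2 e3 ab by auto
  have e23: "e2 \<noteq> e3" using x y ab xb by (auto simp: doubleton_eq_iff)
  have "card {e, e2, e3} = 3" using e2 e3 e23 by simp
  then have C: "C = {e, e2, e3}"
    using card_seteq[of C "{e, e2, e3}"] card_mono[OF fin CB] finite_subset[OF CB fin] e e2 e3 assms(4)
    by simp
  obtain e4 where e4: "e4 \<in> C" "x \<in> e4" "e4 \<noteq> e2"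
    using second_edge_at_vertex[OF no e2(1), of x] x by blast
  then have "x = y" using C ab x y xb by auto
  then have "{a, b} \<in> E" "{b, x} \<in> E" "{a, x} \<in> E"
    using e e2(1) e3(1) ab x y CB assms(3) by auto
  then show False using assms(2) unfolding triangle_free_def by blast
qed

text \<open>Euler's bound with all edges counted, \<open>Q = E\<close>; both of its alternatives
  imply the claim.\<close>

lemma triangle_free_planar_edge_bound:
  assumes "plane_drawing V E pos crv" "simple_graph V E" "triangle_free E" "V \<noteq> {}"
  shows "card E < 2 * card V"
proof -
  have "forest B" if "B \<subseteq> E" "card (B \<inter> E) \<le> 3" for B
    using that forest_small_triangle_free[OF assms(2,3) that(1)] by (simp add: Int_absorb2)
  then have "card E < card V \<or> 2 * card E + 4 \<le> 2 * card V + card E"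
    using plane_graph_edge_bound[OF assms(1,2,4) subset_refl] by blast
  then show ?thesis by linarith
qed

section \<open>Degrees and independent sets\<close>

lemma neighbors_sym: "u \<in> neighbors E v \<longleftrightarrow> v \<in> neighbors E u"
  unfolding neighbors_def by (simp add: insert_commute)

lemma neighbors_subset:
  assumes "simple_graph V E"
  shows "neighbors E v \<subseteq> V"
  using simple_graph_edge(2)[OF assms] unfolding neighbors_def by auto

lemma card_incident_edges: "card {e \<in> E. e \<subseteq> W \<and> v \<in> e} = card (neighbors E v \<inter> W)"
  if "simple_graph V E" "v \<in> W"
proof -
  have "{e \<in> E. e \<subseteq> W \<and> v \<in> e} = (\<lambda>u. {v, u}) ` (neighbors E v \<inter> W)" (is "?L = ?R")
  proof (intro subset_antisym subsetI)
    fix e assume e: "e \<in> ?L"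
    then have "card e = 2" using that(1) unfolding simple_graph_def by blast
    then obtain u where "e = {v, u}"
      using e unfolding card_2_iff by (metis (no_types, lifting) insert_commute insert_iff mem_Collect_eq singletonD)
    then show "e \<in> ?R" using e unfolding neighbors_def by auto
  next
    fix e assume "e \<in> ?R"
    then show "e \<in> ?L" using that(2) unfolding neighbors_def by auto
  qed
  moreover have "inj_on (\<lambda>u. {v, u}) (neighbors E v \<inter> W)"
    by (auto simp: inj_on_def doubleton_eq_iff)
  ultimately show ?thesis by (simp add: card_image)
qed

text \<open>The degrees in the subgraph induced by \<open>W\<close> sum to twice its number of
  edges, hence to less than \<open>4 * card W\<close>.\<close>

lemma small_degree_vertex:
  assumes "plane_drawing V E pos crv" "simple_graph V E" "triangle_free E" "W \<subseteq> V" "W \<noteq> {}"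
  obtains v where "v \<in> W" "card (neighbors E v \<inter> W) \<le> 3"
proof -
  let ?E = "{e \<in> E. e \<subseteq> W}"
  have finW: "finite W" using simple_graph_finite(1)[OF assms(2)] assms(4) finite_subset by blast
  have finE: "finite ?E" using simple_graph_finite(2)[OF assms(2)] by simp
  have G: "plane_drawing W ?E pos crv"
    using plane_drawing_subset[OF assms(1,4), of ?E] by simp
  have s: "simple_graph W ?E"
    using assms(2) finW unfolding simple_graph_def by auto
  have t: "triangle_free ?E" using assms(3) unfolding triangle_free_def by blast
  have "(\<Sum>v\<in>W. card (neighbors E v \<inter> W)) = (\<Sum>v\<in>W. card {e \<in> ?E. v \<in> e})"
    using card_incident_edges[OF assms(2)] by (intro sum.cong) (auto simp: conj_assoc)
  also have "\<dots> = (\<Sum>e\<in>?E. 2)"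
  proof (rule sum_multicount_gen[OF finW finE], intro ballI)
    fix e assume "e \<in> ?E"
    then have "{v \<in> W. v \<in> e} = e" "card e = 2" using assms(2) unfolding simple_graph_def by auto
    then show "card {v \<in> W. v \<in> e} = 2" by simp
  qed
  also have "\<dots> < 4 * card W"
    using triangle_free_planar_edge_bound[OF G s t assms(5)] by simp
  finally have "\<not> (\<forall>v\<in>W. 4 \<le> card (neighbors E v \<inter> W))"
    using sum_bounded_below[of W 4 "\<lambda>v. card (neighbors E v \<inter> W)"] by auto
  then obtain v where v: "v \<in> W" "\<not> 4 \<le> card (neighbors E v \<inter> W)" by blast
  show thesis using that[OF v(1)] v(2) by linarith
qed

text \<open>Greedy choice: each selected vertex costs at most four vertices, itself and at most
  three neighbors.\<close>

lemma large_independent_subset: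
  assumes "plane_drawing V E pos crv" "simple_graph V E" "triangle_free E" "W \<subseteq> V"
  shows "\<exists>I\<subseteq>W. card W \<le> 4 * card I \<and> (\<forall>u\<in>I. \<forall>v\<in>I. {u, v} \<notin> E)"
proof -
  have "finite W" using simple_graph_finite(1)[OF assms(2)] assms(4) finite_subset by blast
  then show ?thesis using assms(4)
  proof (induction W rule: finite_psubset_induct)
    case (psubset W)
    show ?case
    proof (cases "W = {}")
      case False
      obtain v where v: "v \<in> W" "card (neighbors E v \<inter> W) \<le> 3"
        using small_degree_vertex[OF assms(1-3) psubset.prems False] .
      let ?X = "insert v (neighbors E v \<inter> W)"
      obtain I where I: "I \<subseteq> W - ?X" "card (W - ?X) \<le> 4 * card I" "\<forall>u\<in>I. \<forall>w\<in>I. {u, w} \<notin> E"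
        using psubset.IH[of "W - ?X"] v(1) psubset.prems by blast
      have fI: "finite I" using I(1) psubset.hyps finite_subset by blast
      have "card W = card (W - ?X) + card ?X"
        using psubset.hyps v(1) card_Diff_subset[of ?X W] card_mono[of W ?X] by simp
      also have "card ?X \<le> 4"
        using v(2) card_insert_le_m1[of 4 "neighbors E v \<inter> W" v] by simp
      also have "card (W - ?X) + 4 \<le> 4 * card (insert v I)"
        using I fI by (subst card_insert_disjoint) auto
      finally have c: "card W \<le> 4 * card (insert v I)" by simp
      have nv: "{v, w} \<notin> E" if "w \<in> I" for w using that I(1) unfolding neighbors_def by blast
      have "{v, v} \<notin> E" using simple_graph_edge(3)[OF assms(2)] by blast
      then have "\<forall>u\<in>insert v I. \<forall>w\<in>insert v I. {u, w} \<notin> E"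
        using nv I(3) by (auto simp: insert_commute)
      then show ?thesis using c I(1) v(1) by (intro exI[of _ "insert v I"]) auto
    qed simp
  qed
qed

text \<open>Contracting the edges \<open>{c m s, s}\<close> turns the graph considered here into a simple bipartite
  graph between \<open>I\<close> and \<open>S\<close>, in which \<open>m\<close> is adjacent to the elements of \<open>R m\<close>. Instead of
  contracting, Euler's bound is applied with only the remaining edges \<open>{m, c m s}\<close> counted in the
  length of a cycle.\<close>

lemma bipartite_minor_bound:
  assumes pd: "plane_drawing V E pos crv" and sg: "simple_graph V E"
    and IV: "I \<subseteq> V" and SV: "S \<subseteq> V" and IS: "I \<inter> S = {}" and I0: "I \<noteq> {}"
    and R: "\<And>m. m \<in> I \<Longrightarrow> R m \<subseteq> S" "\<And>m. m \<in> I \<Longrightarrow> 3 \<le> card (R m)"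
    and c: "\<And>m s. m \<in> I \<Longrightarrow> s \<in> R m \<Longrightarrow> {m, c m s} \<in> E"
      "\<And>m s. m \<in> I \<Longrightarrow> s \<in> R m \<Longrightarrow> c m s \<in> S \<Longrightarrow> c m s = s"
      "\<And>m s. m \<in> I \<Longrightarrow> s \<in> R m \<Longrightarrow> c m s \<notin> S \<Longrightarrow>
        c m s \<notin> I \<and> \<sigma> (c m s) = s \<and> {c m s, s} \<in> E"
  shows "card I + 4 \<le> 2 * card S"
proof -
  \<comment> \<open>\<open>U\<close> holds the vertices to be contracted and \<open>T\<close> the
    contracted edges. \<open>P\<close> lists the edges of the minor, and \<open>Q\<close> holds the
    edges that represent them.\<close>
  define U where "U = {c m s | m s. m \<in> I \<and> s \<in> R m \<and> c m s \<notin> S}"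
  define T where "T = (\<lambda>u. {u, \<sigma> u}) ` U"
  define P where "P = Sigma I R"
  define Q where "Q = (\<lambda>(m, s). {m, c m s}) ` P"
  have U: "u \<notin> S" "u \<notin> I" "\<sigma> u \<in> S" "{u, \<sigma> u} \<in> E" if uU: "u \<in> U" for u
  proof -
    obtain m s where ms: "u = c m s" "m \<in> I" "s \<in> R m" "c m s \<notin> S"
      using uU unfolding U_def by blast
    then show "u \<notin> S" "u \<notin> I" "\<sigma> u \<in> S" "{u, \<sigma> u} \<in> E" using c(3)[OF ms(2-4)] R(1) by auto
  qed
  have cI: "c m s \<notin> I" if "m \<in> I" "s \<in> R m" for m s
    using c(3)[OF that] IS by blast
  \<comment> \<open>The vertex \<open>c m s\<close> determines \<open>s\<close>, so different
    elements of \<open>R m\<close> use different edges at \<open>m\<close>.\<close>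
  have root: "s = (if c m s \<in> S then c m s else \<sigma> (c m s))" if "m \<in> I" "s \<in> R m" for m s
    using c(2,3)[OF that] by (cases "c m s \<in> S") simp_all
  have c_inj: "s = s'" if "m \<in> I" "s \<in> R m" "s' \<in> R m" "c m s = c m s'" for m s s'
    using root[OF that(1,2)] root[OF that(1,3)] that(4) by metis
  have fin: "finite V" using simple_graph_finite(1)[OF sg] .
  have fI: "finite I" and fS: "finite S" using fin IV SV finite_subset by blast+
  have UV: "U \<subseteq> V" using U(4) simple_graph_edge(1)[OF sg] by blast
  then have fU: "finite U" using fin finite_subset by blast
  have fR: "finite (R m)" if "m \<in> I" for m using R(1)[OF that] fS finite_subset by blast
  have TE: "T \<subseteq> E" unfolding T_def using U(4) by blast
  have QE: "Q \<subseteq> E" unfolding Q_def P_def using c(1) by auto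
  have Q_at: "\<exists>s\<in>R m. q = {m, c m s}" if q: "q \<in> Q" and m: "m \<in> q" "m \<in> I" for q m
  proof -
    obtain m' s where "q = {m', c m' s}" "m' \<in> I" "s \<in> R m'" using q unfolding Q_def P_def by auto
    moreover from this have "m = m'" using m cI by blast
    ultimately show ?thesis by blast
  qed
  have T_at: "e = {u, \<sigma> u}" if "e \<in> T" "u \<in> e" "u \<notin> S" for e u
    using that U(3) unfolding T_def by auto
  have T_no: "m \<notin> e" if "e \<in> T" "m \<in> I" for e m
    using that U(2,3) IS unfolding T_def by auto
  have inj: "inj_on (\<lambda>(m, s). {m, c m s}) P"
  proof (rule inj_onI, clarify)
    fix m s m' s'
    assume p: "(m, s) \<in> P" "(m', s') \<in> P" and eq: "{m, c m s} = {m', c m' s'}"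
    then have mm: "m = m'" using cI[of m s] cI[of m' s'] unfolding P_def by (auto simp: doubleton_eq_iff)
    then have "c m s = c m s'" using eq by (auto simp: doubleton_eq_iff)
    then show "m = m' \<and> s = s'" using c_inj[of m s s'] p mm unfolding P_def by auto
  qed
  have cQ: "card Q = card P" unfolding Q_def by (rule card_image[OF inj])
  have "card P = (\<Sum>m\<in>I. card (R m))" unfolding P_def using fI fR by simp
  then have cP: "3 * card I \<le> card P"
    using sum_bounded_below[of I 3 "\<lambda>m. card (R m)"] R(2) by simp
  have cT: "card T = card U" unfolding T_def
  proof (intro card_image inj_onI)
    fix u u' assume "u \<in> U" "u' \<in> U" "{u, \<sigma> u} = {u', \<sigma> u'}"
    then show "u = u'" using U(1,3) by (auto simp: doubleton_eq_iff)
  qed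
  have TQ: "T \<inter> Q = {}" using T_no unfolding Q_def P_def by fastforce
  have cE: "card (T \<union> Q) = card U + card P"
    using card_Un_disjoint[OF _ _ TQ] cT cQ TE QE simple_graph_finite(2)[OF sg] finite_subset by metis
  have cV: "card (I \<union> S \<union> U) = card I + card S + card U"
  proof -
    have "(I \<union> S) \<inter> U = {}" using U(1,2) by blast
    then show ?thesis using fI fS fU IS by (simp add: card_Un_disjoint)
  qed
  have sub: "T \<subseteq> Pow (I \<union> S \<union> U)" "Q \<subseteq> Pow (I \<union> S \<union> U)"
  proof -
    show "T \<subseteq> Pow (I \<union> S \<union> U)" using U(3) unfolding T_def by auto
    have "c m s \<in> S \<union> U" if "m \<in> I" "s \<in> R m" for m s using that unfolding U_def by blast
    then show "Q \<subseteq> Pow (I \<union> S \<union> U)" unfolding Q_def P_def by fastforce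
  qed
  have H: "plane_drawing (I \<union> S \<union> U) (T \<union> Q) pos crv" "simple_graph (I \<union> S \<union> U) (T \<union> Q)"
  proof -
    show "plane_drawing (I \<union> S \<union> U) (T \<union> Q) pos crv"
      by (rule plane_drawing_subset[OF pd]) (use IV SV UV TE QE in auto)
    have "card e = 2" if "e \<in> T \<union> Q" for e
      using that TE QE sg unfolding simple_graph_def by blast
    moreover have "e \<subseteq> I \<union> S \<union> U" if "e \<in> T \<union> Q" for e using that sub by blast
    ultimately show "simple_graph (I \<union> S \<union> U) (T \<union> Q)"
      unfolding simple_graph_def using fI fS fU by simp
  qed
  \<comment> \<open>A cycle of \<open>T \<union> Q\<close> contracts to one of a simple bipartite
    graph, so it has at least four edges in \<open>Q\<close>. Concretely, in a leafless
    \<open>C\<close> with fewer, all edges of \<open>Q\<close> share one \<open>m\<close>, and then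
    some \<open>s\<close> is a leaf.\<close>
  have "forest B" if BE: "B \<subseteq> T \<union> Q" and BQ: "card (B \<inter> Q) \<le> 3" for B
    unfolding forest_def
  proof (intro allI impI, rule ccontr)
    fix C assume CB: "C \<subseteq> B" and ne: "C \<noteq> {}" and no: "\<not> (\<exists>v. card {e \<in> C. v \<in> e} = 1)"
    have fB: "finite (B \<inter> Q)" using QE simple_graph_finite(2)[OF sg] finite_subset by blast
    have CQ: "card (C \<inter> Q) \<le> 3"
      using card_mono[OF fB, of "C \<inter> Q"] CB BQ by (meson Int_mono le_trans subset_refl)
    have fC: "finite (C \<inter> Q)" using fB CB finite_subset by (metis Int_mono subset_refl)
    have CE: "C \<subseteq> T \<union> Q" using CB BE by blast
    \<comment> \<open>Outside \<open>S\<close>, a vertex lies on only one edge of \<open>T\<close>,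
      so \<open>C\<close> must continue there with an edge of \<open>Q\<close>.\<close>
    have T_Q: "\<exists>q\<in>C \<inter> Q. u \<in> q" if uC: "{u, \<sigma> u} \<in> C" "u \<notin> S" for u
    proof -
      obtain f where f: "f \<in> C" "u \<in> f" "f \<noteq> {u, \<sigma> u}"
        using second_edge_at_vertex[OF no uC(1), of u] by blast
      then have "f \<notin> T" using T_at uC(2) by blast
      then show ?thesis using f CE by blast
    qed
    have "\<exists>q. q \<in> C \<inter> Q"
    proof -
      obtain e where e: "e \<in> C" using ne by blast
      show ?thesis
      proof (cases "e \<in> Q")
        case False
        then obtain u where "e = {u, \<sigma> u}" "u \<in> U" using e CE unfolding T_def by blast
        then show ?thesis using T_Q U(1) e by blast
      qed (use e in blast)
    qed
    then obtain m s where m: "m \<in> I" "s \<in> R m" "{m, c m s} \<in> C" unfolding Q_def P_def by auto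
    \<comment> \<open>No edge of \<open>T\<close> touches \<open>I\<close>, so both edges of
      \<open>C\<close> at \<open>m'\<close> belong to \<open>Q\<close>.\<close>
    have two: "\<exists>q q'. q \<in> C \<inter> Q \<and> q' \<in> C \<inter> Q \<and> q \<noteq> q' \<and> m' \<in> q \<and> m' \<in> q'"
      if m': "m' \<in> I" "q \<in> C \<inter> Q" "m' \<in> q" for m' q
    proof -
      obtain q' where q': "q' \<in> C" "m' \<in> q'" "q' \<noteq> q"
        using second_edge_at_vertex[OF no _ m'(3)] m'(2) by blast
      then have "q' \<in> Q" using T_no m'(1) CE by blast
      then show ?thesis using q' m' by blast
    qed
    have mQ: "{m, c m s} \<in> C \<inter> Q" using m unfolding Q_def P_def by auto
    \<comment> \<open>A second vertex \<open>m'\<close> of \<open>I\<close> would contribute two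
      more edges of \<open>Q\<close>. They differ from those at \<open>m\<close>, as an edge of
      \<open>Q\<close> has only one end in \<open>I\<close>; this makes four.\<close>
    have only_m: "m \<in> q" if q: "q \<in> C \<inter> Q" for q
    proof (rule ccontr)
      assume mq: "m \<notin> q"
      obtain m' s' where m': "q = {m', c m' s'}" "m' \<in> I" "s' \<in> R m'"
        using q unfolding Q_def P_def by auto
      have apart: "m \<notin> p \<or> m' \<notin> p" if "p \<in> Q" for p
        using Q_at[OF that _ m(1)] cI[OF m(1)] m' mq by auto
      obtain q1 q2 where 1: "q1 \<in> C \<inter> Q" "q2 \<in> C \<inter> Q" "q1 \<noteq> q2" "m \<in> q1" "m \<in> q2"
        using two[OF m(1) mQ] by auto
      obtain q3 q4 where 2: "q3 \<in> C \<inter> Q" "q4 \<in> C \<inter> Q" "q3 \<noteq> q4" "m' \<in> q3" "m' \<in> q4"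
        using two[OF m'(2) q] m'(1) by auto
      have "q1 \<noteq> q3" "q1 \<noteq> q4" "q2 \<noteq> q3" "q2 \<noteq> q4" using 1 2 apart by blast+
      then have "card {q1, q2, q3, q4} = 4" using 1(3) 2(3) by simp
      moreover have "card {q1, q2, q3, q4} \<le> card (C \<inter> Q)"
        using 1 2 by (intro card_mono[OF fC]) simp
      ultimately show False using CQ by simp
    qed
    \<comment> \<open>Every connection reaching \<open>s\<close> starts at \<open>m\<close>, and for
      given \<open>m\<close> and \<open>s\<close> there is only one, so its last edge is the only
      edge of \<open>C\<close> at \<open>s\<close>.\<close>
    have at_s: "e = (if c m s = s then {m, s} else {c m s, s})" if e: "e \<in> C" "s \<in> e" for e
    proof (cases "e \<in> Q")
      case True
      then obtain s' where s': "s' \<in> R m" "e = {m, c m s'}"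
        using Q_at[of e m] only_m[of e] e(1) m(1) by blast
      have "s \<in> S" using R(1) m by blast
      then have "s \<noteq> m" using m(1) IS by blast
      then have "c m s' = s" using s' e(2) by auto
      then have "s' = s" using c(2)[OF m(1) s'(1)] \<open>s \<in> S\<close> by simp
      then show ?thesis using s' \<open>c m s' = s\<close> by simp
    next
      case False
      then obtain u where u: "e = {u, \<sigma> u}" "u \<in> U" using e CE unfolding T_def by blast
      have "s \<in> S" using R(1) m by blast
      then have su: "s = \<sigma> u" using u e(2) U(1) by blast
      obtain q where q: "q \<in> C \<inter> Q" "u \<in> q" using T_Q[of u] u e(1) U(1) by blast
      then obtain s' where s': "s' \<in> R m" "q = {m, c m s'}"
        using Q_at[of q m] only_m[of q] m(1) by blast
      have "u \<noteq> m" using U(2) u(2) m(1) by blast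
      then have "u = c m s'" using q(2) s'(2) by auto
      then have "s' = s" using c(3)[OF m(1) s'(1)] U(1)[OF u(2)] su by simp
      then have "c m s \<noteq> s" "c m s = u" using \<open>u = c m s'\<close> U(1)[OF u(2)] \<open>s \<in> S\<close> by auto
      then show ?thesis using u(1) su by simp
    qed
    \<comment> \<open>Either the edge from \<open>m\<close> ends at \<open>s\<close> itself, or
      \<open>C\<close> must leave \<open>c m s\<close> by the contracted edge to
      \<open>s\<close>.\<close>
    have "\<exists>e\<in>C. s \<in> e"
    proof (cases "c m s \<in> S")
      case True
      then show ?thesis using m c(2)[OF m(1,2)] by auto
    next
      case False
      obtain f where f: "f \<in> C" "c m s \<in> f" "f \<noteq> {m, c m s}"
        using second_edge_at_vertex[OF no m(3), of "c m s"] by blast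
      have "f \<notin> Q"
      proof
        assume "f \<in> Q"
        then obtain s' where s': "s' \<in> R m" "f = {m, c m s'}"
          using Q_at[of f m] only_m[of f] f(1) m(1) by blast
        then have "c m s = c m s'" using f(2) cI[OF m(1,2)] m(1) by auto
        then show False using s' f(3) by simp
      qed
      then have "f = {c m s, s}" using T_at[of f "c m s"] f CE False c(3)[OF m(1,2)] by auto
      then show ?thesis using f(1) by blast
    qed
    then obtain e where e: "e \<in> C" "s \<in> e" by blast
    obtain f where f: "f \<in> C" "s \<in> f" "f \<noteq> e" using second_edge_at_vertex[OF no e] .
    show False using at_s[OF e] at_s[OF f(1,2)] f(3) by simp
  qed
  then have "card (T \<union> Q) < card (I \<union> S \<union> U) \<or>
      2 * card (T \<union> Q) + 4 \<le> 2 * card (I \<union> S \<union> U) + card Q"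
    using plane_graph_edge_bound[OF H _ Un_upper2] I0 by blast
  \<comment> \<open>This serves the first alternative, which yields
    \<open>2 * card I < card S\<close>.\<close>
  moreover have "3 \<le> card S"
  proof -
    obtain m where "m \<in> I" using I0 by blast
    then show ?thesis using R[of m] card_mono[OF fS, of "R m"] by linarith
  qed
  ultimately show ?thesis using cE cV cP cQ by linarith
qed

text \<open>Absence of \<open>K\<^sub>3\<^sub>,\<^sub>3\<close>: nothing is contracted, and the
  previous bound reads \<open>card I + 4 \<le> 6\<close> for the set of common neighbors.\<close>

lemma common_neighbors_of_three:
  assumes "plane_drawing V E pos crv" "simple_graph V E" "x \<noteq> y" "x \<noteq> z" "y \<noteq> z"
  shows "card (neighbors E x \<inter> neighbors E y \<inter> neighbors E z) \<le> 2"
proof (cases "neighbors E x \<inter> neighbors E y \<inter> neighbors E z = {}")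
  case False
  let ?I = "neighbors E x \<inter> neighbors E y \<inter> neighbors E z" and ?S = "{x, y, z}"
  have irr: "v \<notin> neighbors E v" for v
    using simple_graph_edge(3)[OF assms(2), of v v] unfolding neighbors_def by auto
  have "card ?I + 4 \<le> 2 * card ?S"
  proof (rule bipartite_minor_bound[where R = "\<lambda>_. ?S" and c = "\<lambda>_ s. s" and \<sigma> = id, OF assms(1,2)])
    show "?I \<subseteq> V" using neighbors_subset[OF assms(2)] by blast
    show "?S \<subseteq> V" using False simple_graph_edge(1)[OF assms(2)] unfolding neighbors_def by blast
    show "?I \<inter> ?S = {}" using irr by auto
    show "{m, s} \<in> E" if "m \<in> ?I" "s \<in> ?S" for m s
      using that unfolding neighbors_def by (auto simp: insert_commute)
  qed (use False assms in auto)
  then show ?thesis using assms by simp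
qed simp

section \<open>The marking algorithm\<close>

lemma triangle_freeD:
  assumes "triangle_free E" "v \<in> neighbors E u" "w \<in> neighbors E v"
  shows "w \<notin> neighbors E u"
  using assms unfolding triangle_free_def neighbors_def by blast

text \<open>An arbitrary \<open>S\<close> is allowed, so that the bound also applies to a total
  dominating set built from a dominating one. The pieces add up to
  \<open>14 * card S\<close>.\<close>

lemma marked_vertices_total_bound:
  assumes pd: "plane_drawing V E pos crv" and sg: "simple_graph V E" and tf: "triangle_free E"
    and r: "\<forall>v\<in>V. 0 < r v \<and> r v < 1" and vm: "valid_marking V E r mark"
    and S: "total_dominating_set V E S"
  shows "card (mark ` V) \<le> 16 * card S"
proof -
  let ?N = "neighbors E"
  have SV: "S \<subseteq> V" using S unfolding total_dominating_set_def by blast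
  have fV: "finite V" using simple_graph_finite(1)[OF sg] .
  then have fS: "finite S" using SV finite_subset by blast
  have NV: "?N v \<subseteq> V" for v using neighbors_subset[OF sg] .
  then have fN: "finite (?N v)" for v using fV finite_subset by blast
  have "\<forall>v\<in>V. \<exists>s\<in>S. s \<in> ?N v" using S unfolding total_dominating_set_def by (rule conjunct2)
  then obtain \<sigma> where \<sigma>: "\<And>v. v \<in> V \<Longrightarrow> \<sigma> v \<in> S" "\<And>v. v \<in> V \<Longrightarrow> \<sigma> v \<in> ?N v" by metis
  have mark: "mark v \<in> ?N v" if "v \<in> V" for v using vm that unfolding valid_marking_def by blast
  \<comment> \<open>The random parts differ by less than one and degrees are integers, so comparing
    weights compares degrees.\<close>
  have deg: "degree E s \<le> degree E (mark v)" if "v \<in> V" "s \<in> ?N v" for v s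
  proof -
    have "weight E r s \<le> weight E r (mark v)" using vm that unfolding valid_marking_def by blast
    moreover have "0 < r s" "r (mark v) < 1" using r that NV mark[OF that(1)] by blast+
    ultimately show ?thesis unfolding weight_def by linarith
  qed
  define R where "R m = (?N m \<inter> S) \<union> \<sigma> ` (?N m - S)" for m
  define A where "A = mark ` V - S - mark ` S"
  define A3 where "A3 = {m \<in> A. 3 \<le> card (R m)}"
  have RS: "R m \<subseteq> S" for m using \<sigma>(1) NV unfolding R_def by blast
  have AV: "A \<subseteq> V" using mark NV unfolding A_def by blast
  then have fA: "finite A" using fV finite_subset by blast

  have A3: "card A3 \<le> 8 * card S"
  proof -
    obtain I where I: "I \<subseteq> A3" "card A3 \<le> 4 * card I" "\<forall>u\<in>I. \<forall>v\<in>I. {u, v} \<notin> E"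
      using large_independent_subset[OF pd sg tf, of A3] AV unfolding A3_def by blast
    show ?thesis
    proof (cases "I = {}")
      case False
      \<comment> \<open>The first vertex on the way from \<open>m\<close> to \<open>s\<close>:
        \<open>s\<close> itself if adjacent, otherwise a neighbor of \<open>m\<close> outside
        \<open>S\<close> assigned to \<open>s\<close>.\<close>
      define c where "c m s = (if s \<in> ?N m then s else SOME u. u \<in> ?N m - S \<and> \<sigma> u = s)" for m s
      have c: "c m s = s \<and> s \<in> ?N m \<or> c m s \<in> ?N m - S \<and> \<sigma> (c m s) = s" if sR: "s \<in> R m" for m s
      proof (cases "s \<in> ?N m")
        case False
        then obtain u where "u \<in> ?N m - S \<and> \<sigma> u = s" using sR unfolding R_def by blast
        from someI[of "\<lambda>u. u \<in> ?N m - S \<and> \<sigma> u = s", OF this] show ?thesis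
          using False unfolding c_def by simp
      qed (simp add: c_def)
      have "card I + 4 \<le> 2 * card S"
      proof (rule bipartite_minor_bound[OF pd sg, where R = R and c = c and \<sigma> = \<sigma>])
        show "I \<subseteq> V" "I \<inter> S = {}" using I(1) AV unfolding A3_def A_def by blast+
        show "3 \<le> card (R m)" if "m \<in> I" for m using that I(1) unfolding A3_def by blast
        show "{m, c m s} \<in> E" if "m \<in> I" "s \<in> R m" for m s
          using c[OF that(2)] unfolding neighbors_def by auto
        show "c m s = s" if "m \<in> I" "s \<in> R m" "c m s \<in> S" for m s
          using c[OF that(2)] that(3) by blast
        show "c m s \<notin> I \<and> \<sigma> (c m s) = s \<and> {c m s, s} \<in> E"
          if "m \<in> I" "s \<in> R m" "c m s \<notin> S" for m s
        proof -
          have s: "s \<in> S" using that RS by blast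
          then have *: "c m s \<in> ?N m" "\<sigma> (c m s) = s" using c[OF that(2)] that(3) by auto
          \<comment> \<open>Here independence of \<open>I\<close> enters: a contracted vertex must
            not itself belong to \<open>I\<close>.\<close>
          moreover have "c m s \<notin> I" using * I(3) that(1) unfolding neighbors_def by blast
          moreover have "s \<in> ?N (c m s)" using \<sigma>(2)[of "c m s"] * NV by auto
          ultimately show ?thesis unfolding neighbors_def by blast
        qed
      qed (use False SV RS in auto)
      then show ?thesis using I(2) by linarith
    qed (use I in simp)
  qed

  have A2: "card (A - A3) \<le> 4 * card S"
  proof -
    have "\<exists>v. v \<in> V - S \<and> mark v = m" if "m \<in> A" for m
      using that SV unfolding A_def by blast
    \<comment> \<open>\<open>p m\<close> is a vertex outside \<open>S\<close> that marks
      \<open>m\<close>; it exists because members of \<open>A\<close> are not marked from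
      \<open>S\<close>.\<close>
    then obtain p where p: "\<And>m. m \<in> A \<Longrightarrow> p m \<in> V - S" "\<And>m. m \<in> A \<Longrightarrow> mark (p m) = m" by metis
    define G where "G s = {m \<in> A - A3. \<sigma> (p m) = s}" for s
    have nb: "card (?N s) \<le> card (?N m \<inter> ?N s) + 1" "s \<noteq> m" if m: "m \<in> G s" for m s
    proof -
      have mA: "m \<in> A" "m \<notin> A3" "\<sigma> (p m) = s" using m unfolding G_def by auto
      have mV: "m \<in> V" and pV: "p m \<in> V" and pS: "p m \<notin> S" using mA AV p by auto
      have mp: "m \<in> ?N (p m)" and sp: "s \<in> ?N (p m)"
        using mark[OF pV] p(2)[OF mA(1)] \<sigma>(2)[OF pV] mA(3) by auto
      have sS: "s \<in> S" using \<sigma>(1)[OF pV] mA(3) by simp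
      then show "s \<noteq> m" using mA(1) unfolding A_def by blast
      have pm: "p m \<in> ?N m" using mp neighbors_sym by metis
      \<comment> \<open>Both \<open>m\<close> and \<open>s\<close> are neighbors of
        \<open>p m\<close>, so an edge between them would close a triangle. In particular
        \<open>\<sigma> m\<close> differs from \<open>s\<close>.\<close>
      have sm: "s \<notin> ?N m" using triangle_freeD[OF tf pm sp] .
      have "\<sigma> m \<in> R m" "s \<in> R m"
        using \<sigma>[OF mV] pm pS mA(3) unfolding R_def by auto
      moreover have "\<sigma> m \<noteq> s" using sm \<sigma>(2)[OF mV] by auto
      moreover have "card (R m) \<le> 2" using mA unfolding A3_def by auto
      ultimately have Rm: "R m = {\<sigma> m, s}"
        using card_seteq[of "R m" "{\<sigma> m, s}"] finite_subset[OF RS fS] by simp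
      have "?N m \<subseteq> insert (\<sigma> m) (?N m \<inter> ?N s)"
      proof
        fix u assume u: "u \<in> ?N m"
        show "u \<in> insert (\<sigma> m) (?N m \<inter> ?N s)"
        proof (cases "u \<in> S")
          case True
          then have "u \<in> R m" using u unfolding R_def by blast
          then show ?thesis using Rm u sm by auto
        next
          case False
          then have "\<sigma> u \<in> R m" using u unfolding R_def by blast
          moreover have su: "\<sigma> u \<in> ?N u" using \<sigma>(2) u NV by blast
          \<comment> \<open>Otherwise \<open>m\<close>, \<open>u\<close> and
            \<open>\<sigma> m\<close> would form a triangle. Only \<open>s\<close> remains as the
            value of \<open>\<sigma> u\<close>.\<close>
          moreover have "\<sigma> u \<noteq> \<sigma> m" using triangle_freeD[OF tf u su] \<sigma>(2)[OF mV] by auto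
          ultimately have "s \<in> ?N u" using Rm by auto
          then show ?thesis using u neighbors_sym by fast
        qed
      qed
      then have "card (?N m) \<le> card (?N m \<inter> ?N s) + 1"
        using card_mono[of "insert (\<sigma> m) (?N m \<inter> ?N s)" "?N m"] fN[of m]
          card_insert_le_m1 by (auto simp: card_insert_if split: if_splits)
      then show "card (?N s) \<le> card (?N m \<inter> ?N s) + 1"
        using deg[OF pV sp] p(2)[OF mA(1)] unfolding degree_def by simp
    qed
    \<comment> \<open>If \<open>s\<close> has at most four neighbors, \<open>p\<close> maps
      \<open>G s\<close> injectively into them. With \<open>d \<ge> 5\<close> neighbors, two members
      of \<open>G s\<close> would share at least \<open>d - 2 \<ge> 3\<close> of them, so
      \<open>G s\<close> has at most one element.\<close>
    have G4: "card (G s) \<le> 4" for s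
    proof (cases "card (?N s) \<le> 4")
      case True
      have "inj_on p (G s)" using p(2) unfolding G_def by (intro inj_on_inverseI[of _ mark]) simp
      moreover have "p ` G s \<subseteq> ?N s"
      proof
        fix v assume "v \<in> p ` G s"
        then have v: "v \<in> V" "\<sigma> v = s" using p(1) unfolding G_def by auto
        then have "s \<in> ?N v" using \<sigma>(2)[OF v(1)] by simp
        then show "v \<in> ?N s" by (simp add: neighbors_sym)
      qed
      ultimately show ?thesis using card_inj_on_le[OF _ _ fN[of s]] True by (meson le_trans)
    next
      case False
      have "m = m'" if m: "m \<in> G s" "m' \<in> G s" for m m'
      proof (rule ccontr)
        assume "m \<noteq> m'"
        then have "card (?N s \<inter> ?N m \<inter> ?N m') \<le> 2"
          using common_neighbors_of_three[OF pd sg] nb(2) m by blast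
        moreover have "card (?N m \<inter> ?N s) + card (?N m' \<inter> ?N s) =
            card ((?N m \<inter> ?N s) \<union> (?N m' \<inter> ?N s)) + card (?N s \<inter> ?N m \<inter> ?N m')"
          using card_Un_Int[of "?N m \<inter> ?N s" "?N m' \<inter> ?N s"] fN
          by (simp add: Int_ac)
        moreover have "card ((?N m \<inter> ?N s) \<union> (?N m' \<inter> ?N s)) \<le> card (?N s)"
          using fN by (intro card_mono) auto
        ultimately show False using nb(1)[OF m(1)] nb(1)[OF m(2)] False by linarith
      qed
      then have "card (G s) \<le> 1" by (metis card_le_Suc0_iff_eq One_nat_def card.infinite le0)
      then show ?thesis by simp
    qed
    have "A - A3 \<subseteq> (\<Union>s\<in>S. G s)"
      using p(1) \<sigma>(1) unfolding G_def by blast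
    then have "card (A - A3) \<le> card (\<Union>s\<in>S. G s)"
      using fS fA by (intro card_mono) (auto simp: G_def)
    also have "\<dots> \<le> (\<Sum>s\<in>S. card (G s))" using card_UN_le[OF fS] .
    also have "\<dots> \<le> card S * 4" using sum_bounded_above[of S "\<lambda>s. card (G s)" 4] G4 by simp
    finally show ?thesis by simp
  qed

  have "mark ` V \<subseteq> (S \<union> mark ` S) \<union> (A3 \<union> (A - A3))"
    unfolding A_def by blast
  then have "card (mark ` V) \<le> card ((S \<union> mark ` S) \<union> (A3 \<union> (A - A3)))"
    using fS fA by (intro card_mono) (auto simp: A3_def)
  also have "\<dots> \<le> (card S + card (mark ` S)) + (card A3 + card (A - A3))"
    by (meson add_mono card_Un_le le_trans)
  also have "card (mark ` S) \<le> card S" using card_image_le[OF fS] .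
  finally show ?thesis using A3 A2 by linarith
qed

theorem theorem2p1:
  fixes V :: "'a set" and E :: "'a set set" and r :: "'a \<Rightarrow> real" and mark :: "'a \<Rightarrow> 'a"
  assumes "simple_graph V E"
    and "planar V E"
    and "triangle_free E"
    and "no_isolated_vertices V E"
    and "\<forall>v\<in>V. 0 < r v \<and> r v < 1"
    and "valid_marking V E r mark"
  shows "total_dominating_set V E (mark ` V) \<and>
         dominating_set V E (mark ` V) \<and>
         card (mark ` V) \<le> 16 * total_domination_number V E \<and>
         card (mark ` V) \<le> 32 * domination_number V E"
proof -
  obtain pos crv where pd: "plane_drawing V E pos crv" using assms(2) unfolding planar_def by blast
  note bound = marked_vertices_total_bound[OF pd assms(1,3,5,6)]
  have fV: "finite V" using simple_graph_finite(1)[OF assms(1)] .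
  have mark: "mark v \<in> neighbors E v" if "v \<in> V" for v
    using assms(6) that unfolding valid_marking_def by blast
  have markV: "mark ` V \<subseteq> V" using mark neighbors_subset[OF assms(1)] by blast
  then have tot: "total_dominating_set V E (mark ` V)"
    using mark unfolding total_dominating_set_def by blast
  then have dom: "dominating_set V E (mark ` V)"
    unfolding total_dominating_set_def dominating_set_def by blast
  \<comment> \<open>The minimum is attained because the marked set itself is feasible.\<close>
  have "\<exists>S. total_dominating_set V E S \<and> card S = total_domination_number V E"
    unfolding total_domination_number_def by (rule LeastI[of _ "card (mark ` V)"]) (use tot in blast)
  then have 1: "card (mark ` V) \<le> 16 * total_domination_number V E" using bound by force
  have "\<exists>S. dominating_set V E S \<and> card S = domination_number V E"
    unfolding domination_number_def by (rule LeastI[of _ "card (mark ` V)"]) (use dom in blast)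
  then obtain D where D: "dominating_set V E D" "card D = domination_number V E" by blast
  have DV: "D \<subseteq> V" using D(1) unfolding dominating_set_def by blast
  \<comment> \<open>Vertices outside \<open>D\<close> have a neighbor in \<open>D\<close>, and each
    vertex of \<open>D\<close> has the one it marks. The size at most doubles, whence 32.\<close>
  have "total_dominating_set V E (D \<union> mark ` D)"
    using D(1) mark markV DV unfolding total_dominating_set_def dominating_set_def by blast
  then have "card (mark ` V) \<le> 16 * card (D \<union> mark ` D)" by (rule bound)
  also have "card (D \<union> mark ` D) \<le> 2 * card D"
    using card_Un_le[of D "mark ` D"] card_image_le[of D mark] finite_subset[OF DV fV] by linarith
  finally have "card (mark ` V) \<le> 32 * domination_number V E" using D(2) by simp
  then show ?thesis using 1 tot dom by blast
qed

end
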